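(* Let $w$ be a closed web. Then all colorings of $w$ are Kempe-equivalent: for any two colorings $c,c'$ of $w$ by three colors, there is a finite sequence of colorings $c=c_0,c_1,\dots,c_n=c'$ of $w$ such that for each $i$ with $0\le i<n$ there is a bi-colored cycle $C_i$ in $w_{c_i}$ with $c_{i+1}=\tau_{C_i}(c_i)$.
   Context: A closed web is a finite 3-regular oriented multigraph, possibly with some vertex-less loops (oriented circles), smoothly embedded in $\mathbb{R}^2$, such that every vertex is either a sink or a source. Let $\mathbb{S}=\{\mathrm{red},\mathrm{green},\mathrm{blue}\}$ and, for $u\in\mathbb{S}$, $\mathbb{S}_u=\mathbb{S}\setminus\{u\}$. A coloring of $w$ is a function from the set of edges and vertex-less circles of $w$ to $\mathbb{S}$ such that adjacent edges get different colors. $w_c$ denotes $w$ together with a coloring $c$. An $\mathbb{S}_u$-bi-colored cycle in $w_c$ is a connected component of what remains of $w_c$ after deleting all edges and circles of color $u$ (that is, either a vertex-less circle with color in $\mathbb{S}_u$, or a cycle whose edges alternate between the two colors of $\mathbb{S}_u$). A bi-colored cycle is an $\mathbb{S}_u$-bi-colored cycle for some $u\in\mathbb{S}$; a vertex-less circle of color $a$ may be regarded as an $\mathbb{S}_u$-bi-colored cycle for either $u\neq a$. For an $\mathbb{S}_u$-bi-colored cycle $C$ in $w_c$, $\tau_C(c)$ (the Kempe change) is the coloring which agrees with $c$ outside $C$ and exchanges the two colors of $\mathbb{S}_u$ on $C$. *)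

theory Defs
  imports "HOL-Analysis.Analysis" "Graph_Theory.Digraph"
begin

section \<open>Smooth curves in the plane\<close>

text \<open>
  The plane is the type \<^typ>\<open>complex\<close>. Smooth means infinitely differentiable; at the ends
  of a compact interval the derivatives are one-sided.
\<close>

definition smooth_curve_on :: "real set \<Rightarrow> (real \<Rightarrow> complex) \<Rightarrow> bool" where
  "smooth_curve_on T g \<longleftrightarrow>
     (\<exists>D. D 0 = g \<and>
        (\<forall>k. \<forall>t\<in>T. (D k has_vector_derivative D (Suc k) t) (at t within T)))"

definition immersed_curve_on :: "real set \<Rightarrow> (real \<Rightarrow> complex) \<Rightarrow> bool" where
  "immersed_curve_on T g \<longleftrightarrow>
     smooth_curve_on T g \<and> (\<forall>t\<in>T. vector_derivative g (at t within T) \<noteq> 0)"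

definition embedded_interval :: "(real \<Rightarrow> complex) \<Rightarrow> bool" where
  "embedded_interval g \<longleftrightarrow> immersed_curve_on {0..1} g \<and> inj_on g {0..1}"

text \<open>An embedding of the circle \<open>\<real>/\<int>\<close>, given as a 1-periodic curve.\<close>

definition embedded_circle :: "(real \<Rightarrow> complex) \<Rightarrow> bool" where
  "embedded_circle g \<longleftrightarrow>
     immersed_curve_on UNIV g \<and> (\<forall>t. g (t + 1) = g t) \<and> inj_on g {0..<1}"

section \<open>Closed webs\<close>

text \<open>
  The vertices are points of the plane. Edges run from tail to head along \<open>edge_curve\<close>, which is
  only relevant on \<open>{0..1}\<close>. Vertex-less circles are indexed by \<open>circles\<close> and oriented by their
  parametrization.
\<close>

record ('e, 'o) plane_web =
  skeleton :: "(complex, 'e) pre_digraph"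
  edge_curve :: "'e \<Rightarrow> real \<Rightarrow> complex"
  circles :: "'o set"
  circle_curve :: "'o \<Rightarrow> real \<Rightarrow> complex"

definition strands :: "('e, 'o) plane_web \<Rightarrow> ('e + 'o) set" where
  "strands w = arcs (skeleton w) <+> circles w"

text \<open>The part of the plane covered by an edge without its endpoints, or by a circle.\<close>

fun strand_image :: "('e, 'o) plane_web \<Rightarrow> 'e + 'o \<Rightarrow> complex set" where
  "strand_image w (Inl e) = edge_curve w e ` {0<..<1}"
| "strand_image w (Inr k) = range (circle_curve w k)"

definition is_sink :: "('v, 'e) pre_digraph \<Rightarrow> 'v \<Rightarrow> bool" where
  "is_sink G v \<longleftrightarrow> out_arcs G v = {}"

definition is_source :: "('v, 'e) pre_digraph \<Rightarrow> 'v \<Rightarrow> bool" where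
  "is_source G v \<longleftrightarrow> in_arcs G v = {}"

text \<open>No condition is imposed on the tangent directions of the three edges at a vertex.\<close>

locale closed_web =
  fixes w :: "('e, 'o) plane_web"
  assumes finite_skeleton: "fin_digraph (skeleton w)"
    and finite_circles: "finite (circles w)"
    and cubic: "\<And>v. v \<in> verts (skeleton w) \<Longrightarrow>
          in_degree (skeleton w) v + out_degree (skeleton w) v = 3"
    and sink_or_source: "\<And>v. v \<in> verts (skeleton w) \<Longrightarrow>
          is_sink (skeleton w) v \<or> is_source (skeleton w) v"
    and edge_embedded: "\<And>e. e \<in> arcs (skeleton w) \<Longrightarrow> embedded_interval (edge_curve w e)"
    and edge_start: "\<And>e. e \<in> arcs (skeleton w) \<Longrightarrow> edge_curve w e 0 = tail (skeleton w) e"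
    and edge_end: "\<And>e. e \<in> arcs (skeleton w) \<Longrightarrow> edge_curve w e 1 = head (skeleton w) e"
    and circle_embedded: "\<And>k. k \<in> circles w \<Longrightarrow> embedded_circle (circle_curve w k)"
    and strands_disjoint: "disjoint_family_on (strand_image w) (strands w)"
    and strands_avoid_verts: "\<And>x. x \<in> strands w \<Longrightarrow>
          strand_image w x \<inter> verts (skeleton w) = {}"

section \<open>Colorings and Kempe changes\<close>

datatype web_color = Red | Green | Blue

definition colors_but :: "web_color \<Rightarrow> web_color set" where
  "colors_but u = UNIV - {u}"

fun adjacent_strands :: "('e, 'o) plane_web \<Rightarrow> 'e + 'o \<Rightarrow> 'e + 'o \<Rightarrow> bool" where
  "adjacent_strands w (Inl e) (Inl f) \<longleftrightarrow>
     e \<in> arcs (skeleton w) \<and> f \<in> arcs (skeleton w) \<and> e \<noteq> f \<and>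
     {tail (skeleton w) e, head (skeleton w) e} \<inter>
       {tail (skeleton w) f, head (skeleton w) f} \<noteq> {}"
| "adjacent_strands w _ _ \<longleftrightarrow> False"

text \<open>
  Colorings are extensional functions, so that equality of colorings is equality on the edges
  and circles of the web.
\<close>

definition coloring :: "('e, 'o) plane_web \<Rightarrow> ('e + 'o \<Rightarrow> web_color) \<Rightarrow> bool" where
  "coloring w c \<longleftrightarrow>
     c \<in> strands w \<rightarrow>\<^sub>E (UNIV :: web_color set) \<and>
     (\<forall>x\<in>strands w. \<forall>y\<in>strands w. adjacent_strands w x y \<longrightarrow> c x \<noteq> c y)"

definition remaining_strands ::
    "('e, 'o) plane_web \<Rightarrow> ('e + 'o \<Rightarrow> web_color) \<Rightarrow> web_color \<Rightarrow> ('e + 'o) set" where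
  "remaining_strands w c u = {x \<in> strands w. c x \<noteq> u}"

definition remaining_adjacency ::
    "('e, 'o) plane_web \<Rightarrow> ('e + 'o \<Rightarrow> web_color) \<Rightarrow> web_color \<Rightarrow> ('e + 'o) rel" where
  "remaining_adjacency w c u =
     {(x, y). x \<in> remaining_strands w c u \<and> y \<in> remaining_strands w c u \<and>
              adjacent_strands w x y}"

text \<open>
  A connected component is represented by its set of edges and circles. No component is an
  isolated vertex, since only one of the three edges at a vertex is deleted.
\<close>

definition bicolored_cycle ::
    "('e, 'o) plane_web \<Rightarrow> ('e + 'o \<Rightarrow> web_color) \<Rightarrow> web_color \<Rightarrow> ('e + 'o) set \<Rightarrow> bool" where
  "bicolored_cycle w c u C \<longleftrightarrow>
     C \<in> remaining_strands w c u // (remaining_adjacency w c u)\<^sup>*"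

text \<open>On \<open>C\<close> the colors lie in \<open>colors_but u\<close>, which has exactly one further element.\<close>

definition kempe_change ::
    "web_color \<Rightarrow> ('e + 'o) set \<Rightarrow> ('e + 'o \<Rightarrow> web_color) \<Rightarrow> 'e + 'o \<Rightarrow> web_color" where
  "kempe_change u C c =
     (\<lambda>x. if x \<in> C then THE b. b \<in> colors_but u \<and> b \<noteq> c x else c x)"

end

theory Submission
  imports Defs "HOL-Complex_Analysis.Winding_Numbers"
begin

text \<open>
  A coloring assigns to every face of the web a point of the triangular lattice: crossing a strand
  of color \<open>a\<close> adds one of three vectors with sum zero. In the coordinate belonging to the colors
  \<open>a\<close> and \<open>b\<close>, this point is the total winding number of the bicolored cycles in these colors,
  which are disjoint Jordan curves; a Kempe change reverses one of them. Orienting each of them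
  according to the parity of its nesting depth makes the coordinate \<open>0\<close> or \<open>1\<close>, that is, it folds
  the image of the web into a strip. Such foldings decrease the distance to the center of a fixed
  triangle unless the image already lies in that triangle. A coloring whose image does is unique,
  since the class of a lattice point modulo the root lattice depends only on the face.
\<close>

section \<open>Jordan curves in the plane\<close>

text \<open>Faces never occur as objects. The lattice point of a face is read off at points outside
  the web, and only finitely many sample points are used, so that the quantity to be minimized is a
  finite sum of nonnegative integers. The sample points lie in pairs near each strand and are fixed
  for all colorings at once, because the coloring in which the folding ends is not known beforehand.
  The obstacle is that edges are not closed, so the winding number of a single edge is in general
  not an integer. Two facts make up for this. The strands of two colors close up to Jordan curves,
  which yields the folding. And each color class covers every vertex exactly once, so that
  \<open>exp (2 * pi * \<i> * height w c a z)\<close> is the same rational function of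
  \<open>z\<close> for all colors and all colorings; this yields the integrality behind the
  uniqueness. A fold helps because it preserves the parity of the coordinate and moves a point
  perpendicularly to the strip: among the candidates on that line the one in the strip is closest to
  the center of the triangle, which lies in all three strips.\<close>

lemma arc_chain:
  fixes g :: "nat \<Rightarrow> real \<Rightarrow> complex"
  assumes arcs: "\<And>i. i < m \<Longrightarrow> arc (g i)"
    and start: "\<And>i. i < m \<Longrightarrow> pathstart (g i) = v i"
    and finish: "\<And>i. i < m \<Longrightarrow> pathfinish (g i) = v (Suc i)"
    and meet: "\<And>i j. i < j \<Longrightarrow> j < m \<Longrightarrow> path_image (g i) \<inter> path_image (g j) \<subseteq> {v j}"
    and "0 < m"
  shows "\<exists>P. arc P \<and> pathstart P = v 0 \<and> pathfinish P = v m \<and>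
      path_image P = (\<Union>i<m. path_image (g i)) \<and>
      (\<forall>z. z \<notin> path_image P \<longrightarrow> winding_number P z = (\<Sum>i<m. winding_number (g i) z))"
  using \<open>0 < m\<close> arcs start finish meet
proof (induction m rule: nat_induct_non_zero)
  case 1
  then show ?case
    by (intro exI[of _ "g 0"]) auto
next
  case (Suc m)
  then obtain P where P: "arc P" "pathstart P = v 0" "pathfinish P = v m"
      "path_image P = (\<Union>i<m. path_image (g i))"
      "\<And>z. z \<notin> path_image P \<Longrightarrow> winding_number P z = (\<Sum>i<m. winding_number (g i) z)"
    by auto
  have g: "arc (g m)" "pathstart (g m) = v m" "pathfinish (g m) = v (Suc m)"
    using Suc by auto
  have img: "path_image (P +++ g m) = (\<Union>i<Suc m. path_image (g i))"
    using P g by (subst path_image_join) (auto simp: lessThan_Suc)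
  have "arc (P +++ g m)"
  proof (rule arc_join)
    show "path_image P \<inter> path_image (g m) \<subseteq> {pathstart (g m)}"
      using Suc.prems(4)[of _ m] P(4) g(2) by fastforce
  qed (use P g in auto)
  moreover have "winding_number (P +++ g m) z = (\<Sum>i<Suc m. winding_number (g i) z)"
    if "z \<notin> path_image (P +++ g m)" for z
  proof -
    have "z \<notin> path_image P" "z \<notin> path_image (g m)"
      using that img P(4) by auto
    then show ?thesis
      using P g by (simp add: winding_number_join arc_imp_path)
  qed
  ultimately show ?case
    using P g img by (intro exI[of _ "P +++ g m"]) auto
qed

text \<open>All arcs but the last join to an arc, and the last one closes it. The condition
  \<open>meet\<close> mentions both ends of both arcs so that it also fits \<open>k = 2\<close>,
  where the two arcs share both of their ends.\<close>

lemma simple_closed_chain: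
  fixes g :: "nat \<Rightarrow> real \<Rightarrow> complex"
  assumes "2 \<le> k"
    and arcs: "\<And>i. i < k \<Longrightarrow> arc (g i)"
    and start: "\<And>i. i < k \<Longrightarrow> pathstart (g i) = v i"
    and finish: "\<And>i. i < k \<Longrightarrow> pathfinish (g i) = v (Suc i)"
    and loop: "v k = v 0" and inj: "inj_on v {..<k}"
    and meet: "\<And>i j. i < j \<Longrightarrow> j < k \<Longrightarrow>
      path_image (g i) \<inter> path_image (g j) \<subseteq> {v i, v (Suc i)} \<inter> {v j, v (Suc j)}"
  obtains P where "simple_path P" "pathfinish P = pathstart P"
    "path_image P = (\<Union>i<k. path_image (g i))"
    "\<And>z. z \<notin> path_image P \<Longrightarrow> winding_number P z = (\<Sum>i<k. winding_number (g i) z)"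
proof -
  obtain m where k: "k = Suc m" and "0 < m"
    using \<open>2 \<le> k\<close> by (cases k) auto
  have veq: "v i = v j \<Longrightarrow> i = j" if "i < k" "j < k" for i j
    using inj that by (auto dest: inj_onD)
  \<comment> \<open>The indices \<open>i\<close>, \<open>Suc i\<close>, \<open>j\<close>,
    \<open>Suc j\<close> are all below \<open>k\<close> here, so by injectivity the only possible
    coincidence is \<open>v (Suc i) = v j\<close>.\<close>
  have "path_image (g i) \<inter> path_image (g j) \<subseteq> {v j}" if "i < j" "j < m" for i j
    using meet[of i j] veq[of i j] veq[of i "Suc j"] veq[of "Suc i" "Suc j"] that k by auto
  moreover have "arc (g i)" "pathstart (g i) = v i" "pathfinish (g i) = v (Suc i)" if "i < m" for i
    using arcs start finish k that by auto
  ultimately have "\<exists>P. arc P \<and> pathstart P = v 0 \<and> pathfinish P = v m \<and>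
      path_image P = (\<Union>i<m. path_image (g i)) \<and>
      (\<forall>z. z \<notin> path_image P \<longrightarrow> winding_number P z = (\<Sum>i<m. winding_number (g i) z))"
    using \<open>0 < m\<close> by (intro arc_chain[of m g v])
  then obtain P where P: "arc P" "pathstart P = v 0" "pathfinish P = v m"
      "path_image P = (\<Union>i<m. path_image (g i))"
      "\<And>z. z \<notin> path_image P \<Longrightarrow> winding_number P z = (\<Sum>i<m. winding_number (g i) z)"
    by blast
  have g: "arc (g m)" "pathstart (g m) = v m" "pathfinish (g m) = v 0"
    using arcs start finish loop k by auto
  have img: "path_image (P +++ g m) = (\<Union>i<k. path_image (g i))"
    using P g k by (subst path_image_join) (auto simp: lessThan_Suc)
  have "simple_path (P +++ g m)"
  proof (rule simple_path_join_loop)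
    have "path_image (g i) \<inter> path_image (g m) \<subseteq> {v 0, v m}" if "i < m" for i
      using meet[of i m] loop that k by auto
    then show "path_image P \<inter> path_image (g m) \<subseteq> {pathstart P, pathstart (g m)}"
      using P g by fastforce
  qed (use P g in auto)
  moreover have "winding_number (P +++ g m) z = (\<Sum>i<k. winding_number (g i) z)"
    if "z \<notin> path_image (P +++ g m)" for z
  proof -
    have "z \<notin> path_image P" "z \<notin> path_image (g m)"
      using that img P(4) k by auto
    then show ?thesis
      using P g k by (simp add: winding_number_join arc_imp_path)
  qed
  ultimately show ?thesis
    using that[of "P +++ g m"] P g img by auto
qed

text \<open>Each curve is connected and misses the other, hence lies entirely inside or entirely
  outside it. If each were inside the other, the two interiors would contain each other; if each
  were outside, the common point \<open>z\<close> and the connectedness of the interiors would give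
  the same. But equal interiors have equal frontiers, which contradicts disjointness.\<close>

lemma jordan_disjoint_cases:
  fixes p q :: "real \<Rightarrow> complex"
  assumes p: "simple_path p" "pathfinish p = pathstart p"
    and q: "simple_path q" "pathfinish q = pathstart q"
    and disj: "path_image p \<inter> path_image q = {}"
    and z: "z \<in> inside (path_image p)" "z \<in> inside (path_image q)"
  shows "(path_image p \<subseteq> inside (path_image q)) \<noteq> (path_image q \<subseteq> inside (path_image p))"
proof -
  have side: "path_image r \<subseteq> inside (path_image s) \<or> path_image r \<subseteq> outside (path_image s)"
    if "simple_path r" "path_image r \<inter> path_image s = {}" for r s :: "real \<Rightarrow> complex"
    using inside_outside_intersect_connected[of "path_image r" "path_image s"]
      inside_Un_outside[of "path_image s"] connected_simple_path_image[of r] that by blast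
  have neq: "inside (path_image p) \<noteq> inside (path_image q)"
  proof
    assume "inside (path_image p) = inside (path_image q)"
    then have "path_image p = path_image q"
      using Jordan_inside_outside[OF p] Jordan_inside_outside[OF q] by metis
    then show False
      using disj by auto
  qed
  have mono: "inside (path_image r) \<subseteq> inside (path_image s)"
    if "simple_path r" "simple_path s" "path_image r \<subseteq> inside (path_image s)"
    for r s :: "real \<Rightarrow> complex"
    using that by (intro inside_inside_compact_connected)
      (auto simp: compact_simple_path_image closed_simple_path_image connected_simple_path_image)
  have sub: "inside (path_image r) \<subseteq> inside (path_image s)"
    if "simple_path r" "pathfinish r = pathstart r" "path_image s \<subseteq> outside (path_image r)"
      "z \<in> inside (path_image r)" "z \<in> inside (path_image s)" for r s :: "real \<Rightarrow> complex"
  proof -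
    have "inside (path_image r) \<inter> path_image s = {}"
      using that(3) inside_Int_outside by blast
    moreover have "connected (inside (path_image r))"
      using Jordan_inside_outside[OF that(1,2)] by blast
    ultimately show ?thesis
      using inside_outside_intersect_connected[of "inside (path_image r)" "path_image s"]
        inside_Un_outside[of "path_image s"] that(4,5) by blast
  qed
  have "\<not> (path_image p \<subseteq> inside (path_image q) \<and> path_image q \<subseteq> inside (path_image p))"
    using neq mono[OF p(1) q(1)] mono[OF q(1) p(1)] by auto
  moreover have "\<not> (path_image p \<subseteq> outside (path_image q) \<and> path_image q \<subseteq> outside (path_image p))"
    using neq sub[OF p, of q] sub[OF q, of p] z by auto
  moreover have "path_image p \<subseteq> inside (path_image q) \<or> path_image p \<subseteq> outside (path_image q)"
    using side[OF p(1) disj] .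
  moreover have "path_image q \<subseteq> inside (path_image p) \<or> path_image q \<subseteq> outside (path_image p)"
    using side[OF q(1), of p] disj by (simp add: Int_commute)
  ultimately show ?thesis
    by argo
qed

text \<open>\<open>R\<close> is a strict linear order on \<open>S\<close>, so the number of elements
  above \<open>i\<close> runs through \<open>0, ..., card S - 1\<close> exactly once, and the sum is
  \<open>1 - 1 + 1 - ...\<close>. For nested curves around a point the exponent is the nesting
  depth.\<close>

lemma alternating_sum_chain:
  fixes R :: "'i \<Rightarrow> 'i \<Rightarrow> bool"
  assumes "finite S"
    and irrefl: "\<And>i. i \<in> S \<Longrightarrow> \<not> R i i"
    and trans: "\<And>i j k. i \<in> S \<Longrightarrow> j \<in> S \<Longrightarrow> k \<in> S \<Longrightarrow> R i j \<Longrightarrow> R j k \<Longrightarrow> R i k"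
    and total: "\<And>i j. i \<in> S \<Longrightarrow> j \<in> S \<Longrightarrow> i \<noteq> j \<Longrightarrow> R i j \<or> R j i"
  shows "(\<Sum>i\<in>S. (-1::int) ^ card {j\<in>S. R i j}) \<in> {0, 1}"
proof -
  define d where "d i = card {j\<in>S. R i j}" for i
  have less: "d j < d i" if "i \<in> S" "j \<in> S" "R i j" for i j
  proof -
    have "{k\<in>S. R j k} \<subset> {k\<in>S. R i k}"
      using that irrefl[of j] trans[of i j] by blast
    then show ?thesis
      unfolding d_def using \<open>finite S\<close> by (intro psubset_card_mono) auto
  qed
  have inj: "inj_on d S"
    using less total by (intro inj_onI) (metis nat_neq_iff)
  have "d i < card S" if "i \<in> S" for i
  proof -
    have "{k\<in>S. R i k} \<subset> S"
      using that irrefl[of i] by blast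
    then show ?thesis
      unfolding d_def using \<open>finite S\<close> by (intro psubset_card_mono) auto
  qed
  then have "d ` S = {..<card S}"
    using card_image[OF inj] by (intro card_subset_eq) auto
  then have "(\<Sum>i\<in>S. (-1::int) ^ d i) = (\<Sum>n<card S. (-1) ^ n)"
    using sum.reindex[OF inj, of "\<lambda>n. (-1::int) ^ n"] by simp
  moreover have "(\<Sum>n<m. (-1::int) ^ n) = (if even m then 0 else 1)" for m
    by (induction m) auto
  ultimately show ?thesis
    unfolding d_def by auto
qed

text \<open>Orient each curve by the parity of its nesting depth: counterclockwise if even.\<close>

lemma disjoint_jordan_curves_orientation:
  fixes P :: "'i \<Rightarrow> real \<Rightarrow> complex"
  assumes "finite I"
    and simple: "\<And>i. i \<in> I \<Longrightarrow> simple_path (P i)"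
    and loop: "\<And>i. i \<in> I \<Longrightarrow> pathfinish (P i) = pathstart (P i)"
    and disj: "\<And>i j. i \<in> I \<Longrightarrow> j \<in> I \<Longrightarrow> i \<noteq> j \<Longrightarrow> path_image (P i) \<inter> path_image (P j) = {}"
  obtains \<sigma> :: "'i \<Rightarrow> int" where "\<And>i. i \<in> I \<Longrightarrow> \<sigma> i = 1 \<or> \<sigma> i = -1"
    "\<And>z. (\<And>i. i \<in> I \<Longrightarrow> z \<notin> path_image (P i)) \<Longrightarrow>
       (\<Sum>i\<in>I. of_int (\<sigma> i) * winding_number (P i) z) \<in> {0, 1}"
proof -
  have "\<exists>s::int. (s = 1 \<or> s = -1) \<and>
      (\<forall>z\<in>inside (path_image (P i)). winding_number (P i) z = of_int s)" if "i \<in> I" for i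
    using simple_closed_path_winding_number_inside[OF simple[OF that]]
    by (metis of_int_1 of_int_minus)
  then obtain s :: "'i \<Rightarrow> int" where s: "\<And>i. i \<in> I \<Longrightarrow> s i = 1 \<or> s i = -1"
      "\<And>i z. i \<in> I \<Longrightarrow> z \<in> inside (path_image (P i)) \<Longrightarrow> winding_number (P i) z = of_int (s i)"
    by metis
  define R where "R i j \<longleftrightarrow> path_image (P i) \<subseteq> inside (path_image (P j))" for i j
  \<comment> \<open>The factor \<open>s i\<close> cancels the orientation that \<open>P i\<close>
    happens to have.\<close>
  define \<sigma> where "\<sigma> i = s i * (-1) ^ card {j\<in>I. R i j}" for i
  have "\<sigma> i = 1 \<or> \<sigma> i = -1" if "i \<in> I" for i
    using s(1)[OF that] unfolding \<sigma>_def by (cases "even (card {j\<in>I. R i j})") auto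
  moreover have "(\<Sum>i\<in>I. of_int (\<sigma> i) * winding_number (P i) z) \<in> {0, 1}"
    if z: "\<And>i. i \<in> I \<Longrightarrow> z \<notin> path_image (P i)" for z
  proof -
    define S where "S = {i\<in>I. z \<in> inside (path_image (P i))}"
    have mono: "inside (path_image (P i)) \<subseteq> inside (path_image (P j))"
      if "i \<in> I" "j \<in> I" "R i j" for i j
      using that unfolding R_def by (intro inside_inside_compact_connected)
        (auto simp: simple compact_simple_path_image closed_simple_path_image connected_simple_path_image)
    have "(\<Sum>i\<in>S. (-1::int) ^ card {j\<in>S. R i j}) \<in> {0, 1}"
    proof (rule alternating_sum_chain)
      show "finite S"
        using \<open>finite I\<close> by (simp add: S_def)
      show "\<not> R i i" if "i \<in> S" for i
        using inside_no_overlap[of "path_image (P i)"] pathstart_in_path_image[of "P i"]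
        unfolding R_def by blast
      show "R i k" if "i \<in> S" "j \<in> S" "k \<in> S" "R i j" "R j k" for i j k
        using mono[of j k] that unfolding R_def S_def by auto
      show "R i j \<or> R j i" if "i \<in> S" "j \<in> S" "i \<noteq> j" for i j
        using jordan_disjoint_cases[of "P i" "P j" z] simple loop disj that
        unfolding R_def S_def by blast
    qed
    moreover have "(\<Sum>i\<in>I. of_int (\<sigma> i) * winding_number (P i) z) =
        of_int (\<Sum>i\<in>S. (-1::int) ^ card {j\<in>S. R i j})"
    proof -
      have out: "winding_number (P i) z = 0" if "i \<in> I - S" for i
        using that z[of i] simple loop
        by (intro winding_number_zero_in_outside) (auto simp: S_def simple_path_imp_path outside_inside)
      have "of_int (\<sigma> i) * winding_number (P i) z = of_int ((-1) ^ card {j\<in>S. R i j})"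
        if "i \<in> S" for i
      proof -
        \<comment> \<open>A curve that encloses a curve around \<open>z\<close> also goes around
          \<open>z\<close>, so the depth counted among all curves is the rank in the chain
          \<open>S\<close>.\<close>
        have "{j\<in>I. R i j} = {j\<in>S. R i j}"
          using mono that by (auto simp: S_def)
        moreover have "s i * s i = 1"
          using s(1)[of i] that by (auto simp: S_def)
        then have "complex_of_int (s i) * of_int (s i) = 1"
          by (metis of_int_1 of_int_mult)
        ultimately show ?thesis
          using s(2)[of i z] that by (simp add: \<sigma>_def S_def mult.assoc mult.left_commute)
      qed
      then have "(\<Sum>i\<in>S. of_int (\<sigma> i) * winding_number (P i) z) =
          of_int (\<Sum>i\<in>S. (-1::int) ^ card {j\<in>S. R i j})"
        by simp
      moreover have "(\<Sum>i\<in>I. of_int (\<sigma> i) * winding_number (P i) z) =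
          (\<Sum>i\<in>S. of_int (\<sigma> i) * winding_number (P i) z)"
        using \<open>finite I\<close> out by (intro sum.mono_neutral_right) (auto simp: S_def)
      ultimately show ?thesis
        by simp
    qed
    ultimately show ?thesis
      by (auto simp del: of_int_sum)
  qed
  ultimately show ?thesis
    using that by blast
qed

text \<open>A point of a Jordan curve is in the closure of both its inside and its outside, so
  \<open>B\<close> meets both, and there the winding numbers are nonzero and zero. The other curves
  miss the connected set \<open>B\<close> and contribute constants. That the values differ is enough
  for the application; neither the size nor the sign of the jump is determined.\<close>

lemma winding_number_jump:
  fixes P :: "'i \<Rightarrow> real \<Rightarrow> complex"
  assumes "finite I" "i \<in> I"
    and simple: "\<And>j. j \<in> I \<Longrightarrow> simple_path (P j)"
    and loop: "\<And>j. j \<in> I \<Longrightarrow> pathfinish (P j) = pathstart (P j)"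
    and B: "open B" "connected B" "q \<in> B" "q \<in> path_image (P i)"
    and disj: "\<And>j. j \<in> I \<Longrightarrow> j \<noteq> i \<Longrightarrow> path_image (P j) \<inter> B = {}"
  obtains z1 z2 where "z1 \<in> B" "z2 \<in> B" "z1 \<notin> path_image (P i)" "z2 \<notin> path_image (P i)"
    "(\<Sum>j\<in>I. winding_number (P j) z1) \<noteq> (\<Sum>j\<in>I. winding_number (P j) z2)"
proof -
  note J = Jordan_inside_outside[OF simple[OF \<open>i \<in> I\<close>] loop[OF \<open>i \<in> I\<close>]]
  have "q \<in> closure (inside (path_image (P i)))" "q \<in> closure (outside (path_image (P i)))"
    using J B(4) unfolding frontier_def by blast+
  then have "B \<inter> inside (path_image (P i)) \<noteq> {}" "B \<inter> outside (path_image (P i)) \<noteq> {}"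
    using B(3) open_Int_closure_eq_empty[OF B(1)] by blast+
  then obtain z1 z2 where z: "z1 \<in> B" "z1 \<in> inside (path_image (P i))"
      "z2 \<in> B" "z2 \<in> outside (path_image (P i))"
    by blast
  have "winding_number (P i) z1 \<noteq> 0"
    using simple_closed_path_winding_number_inside[OF simple[OF \<open>i \<in> I\<close>]] z(2)
    by (metis one_neq_zero neg_equal_0_iff_equal)
  moreover have "winding_number (P i) z2 = 0"
    using z(4) simple loop \<open>i \<in> I\<close>
    by (intro winding_number_zero_in_outside) (auto simp: simple_path_imp_path)
  moreover have "winding_number (P j) z1 = winding_number (P j) z2" if "j \<in> I - {i}" for j
  proof -
    have "winding_number (P j) constant_on B"
      using that disj[of j] simple[of j] loop[of j] B(2)
      by (intro winding_number_constant) (auto simp: simple_path_imp_path)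
    then show ?thesis
      using z unfolding constant_on_def by metis
  qed
  then have "(\<Sum>j\<in>I - {i}. winding_number (P j) z1) = (\<Sum>j\<in>I - {i}. winding_number (P j) z2)"
    by (rule sum.cong[OF refl])
  ultimately have "(\<Sum>j\<in>I. winding_number (P j) z1) \<noteq> (\<Sum>j\<in>I. winding_number (P j) z2)"
    using \<open>finite I\<close> \<open>i \<in> I\<close> by (simp add: sum.remove)
  moreover have "z1 \<notin> path_image (P i)" "z2 \<notin> path_image (P i)"
    using z inside_no_overlap outside_no_overlap by blast+
  ultimately show ?thesis
    using that z by blast
qed

section \<open>Kempe changes\<close>

lemma UNIV_web_color: "(UNIV :: web_color set) = {Red, Green, Blue}"
  by (auto intro: web_color.exhaust)

lemma finite_web_color [simp]: "finite (A :: web_color set)"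
  by (rule finite_subset[OF subset_UNIV]) (simp add: UNIV_web_color)

lemma third_color: "b \<noteq> u \<Longrightarrow> b \<noteq> a \<Longrightarrow> a \<noteq> u \<Longrightarrow> d \<noteq> u \<Longrightarrow> d \<noteq> a \<Longrightarrow> d = (b :: web_color)"
  by (cases a; cases b; cases u; cases d) auto

lemma third_color_exists:
  obtains u :: web_color where "u \<noteq> a" "u \<noteq> b"
proof -
  have "Red \<notin> {a, b} \<or> Green \<notin> {a, b} \<or> Blue \<notin> {a, b}"
    by (cases a; cases b) simp_all
  then show ?thesis
    using that by blast
qed

text \<open>The description is copied from \<open>kempe_change\<close>, which makes
  \<open>kempe_change_eq\<close> a matter of unfolding.\<close>

definition other_color :: "web_color \<Rightarrow> web_color \<Rightarrow> web_color" where
  "other_color u a = (THE b. b \<in> colors_but u \<and> b \<noteq> a)"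

lemma other_color_eq:
  assumes "a \<noteq> u" "b \<noteq> u" "b \<noteq> a"
  shows "other_color u a = b"
  unfolding other_color_def colors_but_def
proof (rule the_equality)
  show "b \<in> UNIV - {u} \<and> b \<noteq> a"
    using assms by simp
  show "d = b" if "d \<in> UNIV - {u} \<and> d \<noteq> a" for d
    using third_color[of b u a d] that assms by simp
qed

lemma other_color:
  assumes "a \<noteq> u"
  shows "other_color u a \<noteq> u" "other_color u a \<noteq> a" "other_color u (other_color u a) = a"
proof -
  obtain b where b: "b \<noteq> u" "b \<noteq> a"
    by (rule third_color_exists)
  have 1: "other_color u a = b"
    using assms b by (intro other_color_eq) auto
  have 2: "other_color u b = a"
    using assms b by (intro other_color_eq) auto
  show "other_color u a \<noteq> u" "other_color u a \<noteq> a" "other_color u (other_color u a) = a"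
    using 1 2 b by auto
qed

lemma kempe_change_eq: "kempe_change u C c x = (if x \<in> C then other_color u (c x) else c x)"
  by (simp add: kempe_change_def other_color_def)

lemma adjacent_strands_sym: "adjacent_strands w x y \<Longrightarrow> adjacent_strands w y x"
  by (cases x; cases y) auto

lemma bicolored_cycle_subset:
  assumes "bicolored_cycle w c u C"
  shows "C \<subseteq> remaining_strands w c u"
proof -
  obtain x where x: "x \<in> remaining_strands w c u" "C = (remaining_adjacency w c u)\<^sup>* `` {x}"
    using assms unfolding bicolored_cycle_def by (auto elim: quotientE)
  have "(x, y) \<in> (remaining_adjacency w c u)\<^sup>* \<Longrightarrow> y \<in> remaining_strands w c u" for y
    by (induction rule: rtrancl_induct) (auto simp: x remaining_adjacency_def)
  then show ?thesis
    using x by auto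
qed

lemma bicolored_cycle_eq:
  assumes "bicolored_cycle w c u C" "x \<in> C"
  shows "C = (remaining_adjacency w c u)\<^sup>* `` {x}"
proof -
  let ?r = "remaining_adjacency w c u"
  obtain y where y: "C = ?r\<^sup>* `` {y}"
    using assms unfolding bicolored_cycle_def by (auto elim: quotientE)
  have "sym ?r"
    by (auto simp: sym_def remaining_adjacency_def intro: adjacent_strands_sym)
  then have "sym (?r\<^sup>*)"
    by (rule sym_rtrancl)
  moreover have "(y, x) \<in> ?r\<^sup>*"
    using y assms(2) by auto
  ultimately have "(x, y) \<in> ?r\<^sup>*"
    by (auto dest: symD)
  then show ?thesis
    using y \<open>(y, x) \<in> ?r\<^sup>*\<close> by (auto intro: rtrancl_trans)
qed

lemma bicolored_cycle_closed:
  assumes "bicolored_cycle w c u C" "x \<in> C" "y \<in> remaining_strands w c u" "adjacent_strands w x y"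
  shows "y \<in> C"
proof -
  have "(x, y) \<in> remaining_adjacency w c u"
    using assms bicolored_cycle_subset[OF assms(1)] by (auto simp: remaining_adjacency_def)
  then show ?thesis
    using bicolored_cycle_eq[OF assms(1,2)] by auto
qed

lemma bicolored_cycle_disjoint:
  assumes "bicolored_cycle w c u C" "bicolored_cycle w c u D" "C \<noteq> D"
  shows "C \<inter> D = {}"
  using bicolored_cycle_eq assms by (metis disjoint_iff)

lemma bicolored_cycle_exists:
  assumes "x \<in> remaining_strands w c u"
  obtains C where "bicolored_cycle w c u C" "x \<in> C"
proof
  show "bicolored_cycle w c u ((remaining_adjacency w c u)\<^sup>* `` {x})"
    using assms unfolding bicolored_cycle_def by (rule quotientI)
qed auto

lemma remaining_strands_kempe_change:
  assumes "C \<subseteq> remaining_strands w c u"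
  shows "remaining_strands w (kempe_change u C c) u = remaining_strands w c u"
  using assms other_color(1) unfolding remaining_strands_def kempe_change_eq by auto

text \<open>The exchange stays within the two colors different from \<open>u\<close>, so the set of
  deleted strands is the same before and after. Hence cycles for the same \<open>u\<close> can be
  changed independently of each other, and a change can be undone.\<close>

lemma bicolored_cycle_kempe_change:
  assumes "C \<subseteq> remaining_strands w c u"
  shows "bicolored_cycle w (kempe_change u C c) u D \<longleftrightarrow> bicolored_cycle w c u D"
  unfolding bicolored_cycle_def remaining_adjacency_def remaining_strands_kempe_change[OF assms] ..

lemma coloring_kempe_change:
  assumes "coloring w c" "bicolored_cycle w c u C"
  shows "coloring w (kempe_change u C c)"
  unfolding coloring_def
proof (intro conjI ballI impI)
  have sub: "C \<subseteq> strands w" "\<And>x. x \<in> C \<Longrightarrow> c x \<noteq> u"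
    using bicolored_cycle_subset[OF assms(2)] by (auto simp: remaining_strands_def)
  show "kempe_change u C c \<in> strands w \<rightarrow>\<^sub>E UNIV"
    using assms(1) sub(1) by (auto simp: coloring_def kempe_change_eq PiE_def extensional_def)
  fix x y assume xy: "x \<in> strands w" "y \<in> strands w" "adjacent_strands w x y"
  have cxy: "c x \<noteq> c y"
    using assms(1) xy by (auto simp: coloring_def)
  \<comment> \<open>\<open>C\<close> is closed under adjacency among the remaining strands, so a
    neighbor outside \<open>C\<close> must carry the deleted color. Within \<open>C\<close> the
    exchange is injective on colors.\<close>
  have "c y = u" if "x \<in> C" "y \<notin> C"
    using bicolored_cycle_closed[OF assms(2) that(1) _ xy(3)] that(2) xy(2)
    by (auto simp: remaining_strands_def)
  moreover have "c x = u" if "y \<in> C" "x \<notin> C"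
    using bicolored_cycle_closed[OF assms(2) that(1) _ adjacent_strands_sym[OF xy(3)]] that(2) xy(1)
    by (auto simp: remaining_strands_def)
  ultimately show "kempe_change u C c x \<noteq> kempe_change u C c y"
    using cxy sub(2) other_color(1)[of "c x" u] other_color(1)[of "c y" u]
      other_color(3)[of "c x" u] other_color(3)[of "c y" u]
    unfolding kempe_change_eq by (metis)
qed

lemma kempe_change_kempe_change:
  assumes "C \<subseteq> remaining_strands w c u"
  shows "kempe_change u C (kempe_change u C c) = c"
  using assms other_color(3)[of _ u] by (auto simp: kempe_change_eq remaining_strands_def fun_eq_iff)

text \<open>Both ends are required to be colorings, so a chain of steps also certifies its
  intermediate members.\<close>

definition kempe_step ::
    "('e, 'o) plane_web \<Rightarrow> ('e + 'o \<Rightarrow> web_color) \<Rightarrow> ('e + 'o \<Rightarrow> web_color) \<Rightarrow> bool" where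
  "kempe_step w c c' \<longleftrightarrow> coloring w c \<and> coloring w c' \<and>
     (\<exists>u C. bicolored_cycle w c u C \<and> c' = kempe_change u C c)"

text \<open>A Kempe change is an involution, and \<open>C\<close> is still a bicolored cycle
  afterwards. Symmetry is what allows two colorings to be connected through a third one that both
  can reach.\<close>

lemma symp_kempe_step: "symp (kempe_step w)"
proof (rule sympI)
  fix c c' assume "kempe_step w c c'"
  then obtain u C where *: "coloring w c" "coloring w c'"
      "bicolored_cycle w c u C" "c' = kempe_change u C c"
    by (auto simp: kempe_step_def)
  have "bicolored_cycle w c' u C" "c = kempe_change u C c'"
    using * bicolored_cycle_kempe_change[OF bicolored_cycle_subset[OF *(3)]]
      kempe_change_kempe_change[OF bicolored_cycle_subset[OF *(3)]] by simp_all
  then show "kempe_step w c' c"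
    using * unfolding kempe_step_def by blast
qed

lemma kempe_equivalent_coloring:
  "(kempe_step w)\<^sup>*\<^sup>* c c' \<Longrightarrow> coloring w c \<Longrightarrow> coloring w c'"
  by (induction rule: rtranclp_induct) (auto simp: kempe_step_def)

lemma kempe_equivalent_Union:
  assumes "coloring w c" "finite F" "\<And>C. C \<in> F \<Longrightarrow> bicolored_cycle w c u C"
  shows "(kempe_step w)\<^sup>*\<^sup>* c (kempe_change u (\<Union>F) c)"
  using assms(2,3)
proof (induction F)
  case empty
  have "kempe_change u {} c = c"
    by (auto simp: kempe_change_eq)
  then show ?case
    by simp
next
  case (insert C F)
  let ?c = "kempe_change u (\<Union>F) c"
  have sub: "\<Union>F \<subseteq> remaining_strands w c u"
    using insert.prems bicolored_cycle_subset by blast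
  have "bicolored_cycle w c u C"
    using insert.prems by simp
  then have cyc: "bicolored_cycle w ?c u C"
    using bicolored_cycle_kempe_change[OF sub] by simp
  have col: "coloring w ?c"
    using kempe_equivalent_coloring insert assms(1) by blast
  have "C \<inter> \<Union>F = {}"
  proof -
    have "C \<inter> D = {}" if "D \<in> F" for D
      using that insert.hyps insert.prems by (intro bicolored_cycle_disjoint[of w c u]) auto
    then show ?thesis
      by blast
  qed
  then have "kempe_change u (\<Union>(insert C F)) c = kempe_change u C ?c"
    by (auto simp: kempe_change_eq fun_eq_iff)
  moreover have "kempe_step w ?c (kempe_change u C ?c)"
    using col coloring_kempe_change[OF col cyc] cyc by (auto simp: kempe_step_def)
  ultimately show ?case
    using insert by (metis insert_iff rtranclp.rtrancl_into_rtrancl)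
qed

section \<open>The strands of a closed web\<close>

definition strand_curve :: "('e, 'o) plane_web \<Rightarrow> 'e + 'o \<Rightarrow> real \<Rightarrow> complex" where
  "strand_curve w x = (case x of Inl e \<Rightarrow> edge_curve w e | Inr k \<Rightarrow> circle_curve w k)"

lemma strand_curve_simps [simp]:
  "strand_curve w (Inl e) = edge_curve w e" "strand_curve w (Inr k) = circle_curve w k"
  by (simp_all add: strand_curve_def)

lemma smooth_curve_on_imp_continuous_on:
  assumes "smooth_curve_on T g"
  shows "continuous_on T g"
proof -
  obtain D where "D 0 = g" "\<And>t. t \<in> T \<Longrightarrow> (D 0 has_vector_derivative D (Suc 0) t) (at t within T)"
    using assms unfolding smooth_curve_on_def by metis
  then show ?thesis
    using has_vector_derivative_continuous continuous_on_eq_continuous_within by metis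
qed

lemma embedded_interval_arc: "embedded_interval g \<Longrightarrow> arc g"
  unfolding embedded_interval_def immersed_curve_on_def arc_def path_def
  using smooth_curve_on_imp_continuous_on by auto

text \<open>\<open>strand_image\<close> of a circle uses the whole real line and
  \<open>path_image\<close> only the unit interval; periodicity moves \<open>t\<close> to
  \<open>frac t\<close>.\<close>

lemma embedded_circle_path_image:
  assumes "embedded_circle g"
  shows "path_image g = range g"
proof -
  have per: "g (t + 1) = g t" for t
    using assms by (simp add: embedded_circle_def)
  have nat: "g (t + real n) = g t" for t n
  proof (induction n)
    case (Suc n)
    then show ?case
      using per[of "t + real n"] by (simp add: algebra_simps)
  qed simp
  have "g (frac t) = g t" for t
  proof (cases "0 \<le> \<lfloor>t\<rfloor>")
    case True
    then have "t = frac t + real (nat \<lfloor>t\<rfloor>)"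
      by (simp add: frac_def)
    then show ?thesis
      using nat[of "frac t" "nat \<lfloor>t\<rfloor>"] by simp
  next
    case False
    then have "frac t = t + real (nat (-\<lfloor>t\<rfloor>))"
      by (simp add: frac_def)
    then show ?thesis
      using nat[of t "nat (-\<lfloor>t\<rfloor>)"] by simp
  qed
  moreover have "frac t \<in> {0..1}" for t :: real
    using frac_lt_1[of t] by (auto simp: less_imp_le)
  ultimately have "g t \<in> g ` {0..1}" for t
    by (metis imageI)
  then show ?thesis
    unfolding path_image_def by auto
qed

lemma embedded_circle_simple:
  assumes "embedded_circle g"
  shows "simple_path g" "pathfinish g = pathstart g"
proof -
  have g: "continuous_on UNIV g" "inj_on g {0..<1}" "g 1 = g 0"
    using assms smooth_curve_on_imp_continuous_on spec[of "\<lambda>t. g (t + 1) = g t" 0]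
    by (auto simp: embedded_circle_def immersed_curve_on_def)
  have "path g"
    using g(1) continuous_on_subset unfolding path_def by blast
  moreover have "loop_free g"
    unfolding loop_free_def
  proof (intro ballI impI)
    fix s t :: real assume st: "s \<in> {0..1}" "t \<in> {0..1}" "g s = g t"
    show "s = t \<or> s = 0 \<and> t = 1 \<or> s = 1 \<and> t = 0"
    proof (cases "s = 1"; cases "t = 1")
      assume "s \<noteq> 1" "t \<noteq> 1"
      then show ?thesis
        using inj_onD[OF g(2) st(3)] st by simp
    next
      assume "s = 1" "t \<noteq> 1"
      then have "g 0 = g t" "t \<in> {0..<1}"
        using g(3) st by simp_all
      then have "0 = t"
        by (intro inj_onD[OF g(2)]) simp_all
      then show ?thesis
        using \<open>s = 1\<close> by simp
    next
      assume "s \<noteq> 1" "t = 1"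
      then have "g s = g 0" "s \<in> {0..<1}"
        using g(3) st by simp_all
      then have "s = 0"
        by (intro inj_onD[OF g(2)]) simp_all
      then show ?thesis
        using \<open>t = 1\<close> by simp
    qed simp
  qed
  ultimately show "simple_path g"
    by (simp add: simple_path_def)
  show "pathfinish g = pathstart g"
    using g(3) by (simp add: pathfinish_def pathstart_def)
qed

context closed_web
begin

sublocale G: fin_digraph "skeleton w"
  by (rule finite_skeleton)

abbreviation "hd_of \<equiv> head (skeleton w)"
abbreviation "tl_of \<equiv> tail (skeleton w)"
abbreviation "vs \<equiv> verts (skeleton w)"
abbreviation "es \<equiv> arcs (skeleton w)"

lemma finite_strands [simp]: "finite (strands w)"
  by (simp add: strands_def finite_circles)

lemma Inl_strands [simp]: "Inl e \<in> strands w \<longleftrightarrow> e \<in> es"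
  and Inr_strands [simp]: "Inr k \<in> strands w \<longleftrightarrow> k \<in> circles w"
  by (auto simp: strands_def)

lemma arc_edge_curve: "e \<in> es \<Longrightarrow> arc (edge_curve w e)"
  using edge_embedded embedded_interval_arc by blast

lemma edge_ends [simp]:
  assumes "e \<in> es"
  shows "pathstart (edge_curve w e) = tl_of e" "pathfinish (edge_curve w e) = hd_of e"
  using edge_start edge_end assms by (auto simp: pathstart_def pathfinish_def)

lemma path_strand_curve: "x \<in> strands w \<Longrightarrow> path (strand_curve w x)"
  using arc_imp_path[OF arc_edge_curve]
    simple_path_imp_path[OF embedded_circle_simple(1)[OF circle_embedded]]
  by (cases x) simp_all

lemma path_image_edge:
  assumes "e \<in> es"
  shows "path_image (edge_curve w e) = strand_image w (Inl e) \<union> {tl_of e, hd_of e}"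
proof -
  have "{0..1::real} = {0<..<1} \<union> {0, 1}"
    by auto
  then show ?thesis
    using assms edge_start edge_end by (auto simp: path_image_def image_Un)
qed

lemma path_image_circle:
  assumes "k \<in> circles w"
  shows "path_image (circle_curve w k) = strand_image w (Inr k)"
  using embedded_circle_path_image circle_embedded assms by auto

lemma strand_image_subset: "x \<in> strands w \<Longrightarrow> strand_image w x \<subseteq> path_image (strand_curve w x)"
  using path_image_edge path_image_circle by (cases x) (auto simp del: strand_image.simps)

lemma strand_image_Int:
  assumes "x \<in> strands w" "y \<in> strands w" "x \<noteq> y"
  shows "strand_image w x \<inter> path_image (strand_curve w y) = {}"
proof -
  have "strand_image w x \<inter> strand_image w y = {}" "strand_image w x \<inter> vs = {}"
    using strands_disjoint assms strands_avoid_verts unfolding disjoint_family_on_def by auto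
  then show ?thesis
    using assms(2) path_image_edge path_image_circle
    by (cases y) (auto simp del: strand_image.simps)
qed

lemma path_image_strands_Int:
  assumes "x \<in> strands w" "y \<in> strands w" "x \<noteq> y"
    and "p \<in> path_image (strand_curve w x)" "p \<in> path_image (strand_curve w y)"
  obtains e f where "x = Inl e" "y = Inl f" "p \<in> {tl_of e, hd_of e}" "p \<in> {tl_of f, hd_of f}"
proof -
  have "p \<notin> strand_image w x" "p \<notin> strand_image w y"
    using strand_image_Int[OF assms(1-3)] strand_image_Int[OF assms(2,1)] assms(3-5) by auto
  then show ?thesis
    using that assms path_image_edge path_image_circle
    by (cases x; cases y) (auto simp del: strand_image.simps)
qed

text \<open>The link from topology to combinatorics: two strands can meet only in a common end of
  two edges.\<close>

lemma strands_meet_adjacent: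
  assumes "x \<in> strands w" "y \<in> strands w" "x \<noteq> y"
    and "path_image (strand_curve w x) \<inter> path_image (strand_curve w y) \<noteq> {}"
  shows "adjacent_strands w x y"
proof -
  obtain p where "p \<in> path_image (strand_curve w x)" "p \<in> path_image (strand_curve w y)"
    using assms(4) by auto
  then obtain e f where "x = Inl e" "y = Inl f" "p \<in> {tl_of e, hd_of e}" "p \<in> {tl_of f, hd_of f}"
    using path_image_strands_Int assms by metis
  then show ?thesis
    using assms by auto
qed

section \<open>Color classes as perfect matchings\<close>

text \<open>A vertex that is the tail of one edge and the head of another is neither a sink nor a
  source. Thus the web is bipartite, and the case \<open>e = f\<close> excludes loop edges.\<close>

lemma tail_neq_head:
  assumes "e \<in> es" "f \<in> es"
  shows "tl_of e \<noteq> hd_of f"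
  using sink_or_source[of "tl_of e"] assms
  by (auto simp: is_sink_def is_source_def in_arcs_def out_arcs_def)

lemma colored_edge_unique:
  assumes "coloring w c" "e \<in> es" "f \<in> es" "c (Inl e) = c (Inl f)"
    and "{tl_of e, hd_of e} \<inter> {tl_of f, hd_of f} \<noteq> {}"
  shows "e = f"
proof (rule ccontr)
  assume "e \<noteq> f"
  then have "adjacent_strands w (Inl e) (Inl f)"
    using assms by auto
  then show False
    using assms(1-4) by (auto simp: coloring_def)
qed

text \<open>The incoming and outgoing edges at \<open>v\<close> are three different edges, one of
  the two kinds being absent. They have pairwise different colors, so all three colors
  occur.\<close>

lemma colored_edge_exists:
  assumes "coloring w c" "v \<in> vs"
  obtains e where "e \<in> es" "v \<in> {tl_of e, hd_of e}" "c (Inl e) = a"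
proof -
  define S where "S = in_arcs (skeleton w) v \<union> out_arcs (skeleton w) v"
  have fin: "finite (in_arcs (skeleton w) v)" "finite (out_arcs (skeleton w) v)"
    by auto
  have "in_arcs (skeleton w) v \<inter> out_arcs (skeleton w) v = {}"
    using sink_or_source[OF assms(2)] by (auto simp: is_sink_def is_source_def)
  then have "card S = 3"
    using cubic[OF assms(2)] fin unfolding S_def in_degree_def out_degree_def
    by (simp add: card_Un_disjoint)
  moreover have "inj_on (\<lambda>e. c (Inl e)) S"
    using colored_edge_unique[OF assms(1)]
    by (intro inj_onI) (auto simp: S_def in_arcs_def out_arcs_def)
  ultimately have "card ((\<lambda>e. c (Inl e)) ` S) = card (UNIV :: web_color set)"
    by (simp add: card_image UNIV_web_color)
  then have "(\<lambda>e. c (Inl e)) ` S = UNIV"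
    by (intro card_subset_eq) auto
  then obtain e where "e \<in> S" "c (Inl e) = a"
    by (metis UNIV_I imageE)
  then show ?thesis
    using that by (auto simp: S_def in_arcs_def out_arcs_def)
qed

end

section \<open>Bicolored cycles are Jordan curves\<close>

context closed_web
begin

text \<open>Each remaining edge has exactly one successor, the edge of the other color at its end.
  The successor map is injective on a finite set, so the orbit of \<open>e\<close> is periodic. It
  exhausts the component, since an edge adjacent to a member of the orbit is its successor or its
  predecessor. Index \<open>0\<close> follows \<open>k - 1\<close> in the conclusion.\<close>

lemma edge_component_arcs:
  assumes c: "coloring w c" and cyc: "bicolored_cycle w c u C" and e: "Inl e \<in> C"
    and ab: "a \<noteq> b" "a \<noteq> u" "b \<noteq> u"
  obtains k f where "2 \<le> (k::nat)" "C = Inl ` f ` {..<k}" "inj_on f {..<k}"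
    "\<And>i. i < k \<Longrightarrow> f i \<in> es"
    "\<And>i. i < k \<Longrightarrow> (if c (Inl (f i)) = a then hd_of (f i) else tl_of (f i)) =
       (let j = if Suc i = k then 0 else Suc i
        in if c (Inl (f j)) = a then tl_of (f j) else hd_of (f j))"
    "inj_on (\<lambda>i. if c (Inl (f i)) = a then tl_of (f i) else hd_of (f i)) {..<k}"
proof -
  define E where "E = {e \<in> es. c (Inl e) \<noteq> u}"
  define st where "st e = (if c (Inl e) = a then tl_of e else hd_of e)" for e
  define en where "en e = (if c (Inl e) = a then hd_of e else tl_of e)" for e
  have col: "c (Inl f) = a \<or> c (Inl f) = b" if "f \<in> E" for f
    using that third_color[of b u a "c (Inl f)"] ab by (auto simp: E_def)
  have ends: "{st f, en f} = {tl_of f, hd_of f}" for f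
    by (auto simp: st_def en_def)
  \<comment> \<open>An \<open>a\<close>-edge starts at a source and a \<open>b\<close>-edge at a
    sink, so edges with the same start have the same color, and a color occurs only once at a
    vertex. For ends the roles are exchanged.\<close>
  have st_inj: "f = g" if "f \<in> E" "g \<in> E" "st f = st g" for f g
  proof (rule colored_edge_unique[OF c])
    show "c (Inl f) = c (Inl g)"
      using that col[of f] col[of g] ab tail_neq_head[of f g] tail_neq_head[of g f]
      by (auto simp: st_def E_def split: if_splits)
  qed (use that in \<open>auto simp: st_def E_def split: if_splits\<close>)
  have en_inj: "f = g" if "f \<in> E" "g \<in> E" "en f = en g" for f g
  proof (rule colored_edge_unique[OF c])
    show "c (Inl f) = c (Inl g)"
      using that col[of f] col[of g] ab tail_neq_head[of f g] tail_neq_head[of g f]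
      by (auto simp: en_def E_def split: if_splits)
  qed (use that in \<open>auto simp: en_def E_def split: if_splits\<close>)
  have st_en: "st f \<noteq> en f" if "f \<in> E" for f
    using that tail_neq_head[of f f] by (auto simp: st_def en_def E_def split: if_splits)
  have "\<exists>g\<in>E. st g = en f" if f: "f \<in> E" for f
  proof (cases "c (Inl f) = a")
    case True
    obtain g where g: "g \<in> es" "hd_of f \<in> {tl_of g, hd_of g}" "c (Inl g) = b"
      using colored_edge_exists[OF c, of "hd_of f" b] f by (auto simp: E_def)
    then have "g \<in> E" "st g = en f"
      using True ab f tail_neq_head[of g f] by (auto simp: E_def st_def en_def)
    then show ?thesis by blast
  next
    case False
    obtain g where g: "g \<in> es" "tl_of f \<in> {tl_of g, hd_of g}" "c (Inl g) = a"
      using colored_edge_exists[OF c, of "tl_of f" a] f by (auto simp: E_def)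
    then have "g \<in> E" "st g = en f"
      using False ab f tail_neq_head[of f g] by (auto simp: E_def st_def en_def)
    then show ?thesis by blast
  qed
  then obtain \<pi> where \<pi>: "\<And>f. f \<in> E \<Longrightarrow> \<pi> f \<in> E" "\<And>f. f \<in> E \<Longrightarrow> st (\<pi> f) = en f"
    by metis
  have eE: "e \<in> E"
    using e bicolored_cycle_subset[OF cyc] by (auto simp: E_def remaining_strands_def)
  define f where "f i = (\<pi> ^^ i) e" for i
  have fE: "f i \<in> E" for i
    unfolding f_def by (induction i) (use eE \<pi>(1) in auto)
  have f_Suc: "f (Suc i) = \<pi> (f i)" for i
    by (simp add: f_def)
  have pred: "f i = f j" if "f (Suc i) = f (Suc j)" for i j
    using en_inj[OF fE fE] \<pi>(2)[OF fE] f_Suc that by metis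
  have "finite E"
    by (simp add: E_def)
  then have "\<not> inj f"
    using fE by (metis finite_subset image_subsetI infinite_UNIV_nat finite_imageD)
  then obtain i j where ij: "i < j" "f i = f j"
    by (metis injI linorder_neqE_nat)
  \<comment> \<open>Injectivity of the successor map moves a repetition back to the beginning, so
    the orbit is periodic without a preperiod.\<close>
  have "f i = f (i + d) \<Longrightarrow> f 0 = f d" for i d
  proof (induction i)
    case (Suc i)
    then show ?case
      using pred[of i "i + d"] by simp
  qed simp
  from this[of i "j - i"] have "0 < j - i \<and> f (j - i) = e"
    using ij by (simp add: f_def)
  then have ex: "\<exists>m. 0 < m \<and> f m = e"
    by blast
  define k where "k = (LEAST m. 0 < m \<and> f m = e)"
  have k: "0 < k" "f k = e" "\<And>m. 0 < m \<Longrightarrow> m < k \<Longrightarrow> f m \<noteq> e"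
    using LeastI_ex[OF ex] not_less_Least[of _ "\<lambda>m. 0 < m \<and> f m = e"] unfolding k_def by blast+
  have inj: "inj_on f {..<k}"
    using inj_on_funpow_least[of k \<pi> e] k unfolding f_def by (simp add: lessThan_atLeast0)
  \<comment> \<open>The successor of \<open>e\<close> starts where \<open>e\<close> ends, which
    differs from the start of \<open>e\<close>. So at least two edges are needed to close the
    cycle.\<close>
  have "f 1 \<noteq> e"
    using \<pi>(2)[OF eE] st_en[OF eE] by (auto simp: f_def)
  then have "2 \<le> k"
    using k by (cases "k = 1") auto
  have adj: "adjacent_strands w (Inl g) (Inl (\<pi> g))" if "g \<in> E" for g
  proof -
    have "\<pi> g \<noteq> g"
      using \<pi>(2)[OF that] st_en[OF that] by auto
    moreover have "st (\<pi> g) \<in> {tl_of g, hd_of g}" "st (\<pi> g) \<in> {tl_of (\<pi> g), hd_of (\<pi> g)}"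
      using \<pi>(2)[OF that] ends by blast+
    ultimately show ?thesis
      using that \<pi>(1)[OF that] by (auto simp: E_def)
  qed
  have sub: "Inl (f i) \<in> C" for i
  proof (induction i)
    case 0
    then show ?case
      using e by (simp add: f_def)
  next
    case (Suc i)
    have "Inl (f (Suc i)) \<in> remaining_strands w c u"
      using fE[of "Suc i"] by (auto simp: E_def remaining_strands_def)
    then show ?case
      using bicolored_cycle_closed[OF cyc Suc] adj[OF fE] by (simp add: f_Suc)
  qed
  have "C \<subseteq> Inl ` f ` {..<k}"
  proof
    fix x assume "x \<in> C"
    then have "(Inl e, x) \<in> (remaining_adjacency w c u)\<^sup>*"
      using bicolored_cycle_eq[OF cyc e] by auto
    then show "x \<in> Inl ` f ` {..<k}"
    proof (induction rule: rtrancl_induct)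
      case base
      then show ?case
        using k(1) by (auto simp: f_def intro!: image_eqI[of _ _ 0])
    next
      case (step y z)
      then obtain i where i: "i < k" "y = Inl (f i)"
        by auto
      obtain g where g: "z = Inl g" "g \<in> E" "g \<noteq> f i"
          "{tl_of (f i), hd_of (f i)} \<inter> {tl_of g, hd_of g} \<noteq> {}"
        using step(2) i by (cases z) (auto simp: remaining_adjacency_def remaining_strands_def E_def)
      then have "{st (f i), en (f i)} \<inter> {st g, en g} \<noteq> {}"
        using ends by simp
      then have "st g = en (f i) \<or> st (f i) = en g"
        using st_inj[OF fE g(2)] en_inj[OF fE g(2)] g(3) by auto
      then show ?case
      proof
        assume "st g = en (f i)"
        then have "g = f (Suc i)"
          using st_inj[OF g(2) fE[of "Suc i"]] \<pi>(2)[OF fE[of i]] by (simp add: f_Suc)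
        moreover have "f (Suc i) \<in> f ` {..<k}"
        proof (cases "Suc i = k")
          case True
          then have "f (Suc i) = f 0"
            using k(2) by (simp add: f_def)
          then show ?thesis
            using k(1) by auto
        qed (use i in auto)
        ultimately show ?thesis
          using g by auto
      next
        assume st: "st (f i) = en g"
        \<comment> \<open>The index of the predecessor; for \<open>i = 0\<close> it is
          \<open>k - 1\<close>, because \<open>f k = e\<close>.\<close>
        obtain j where j: "j < k" "f i = f (Suc j)"
        proof (cases i)
          case 0
          then show ?thesis
            using that[of "k - 1"] k by (auto simp: f_def)
        next
          case (Suc n)
          then show ?thesis
            using that[of n] i by simp
        qed
        then have "en g = en (f j)"
          using st \<pi>(2)[OF fE] by (simp add: f_Suc)
        then have "g = f j"
          using en_inj[OF g(2) fE] by blast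
        then show ?thesis
          using j g by auto
      qed
    qed
  qed
  then have "C = Inl ` f ` {..<k}"
    using sub by auto
  moreover have "en (f i) = (let j = if Suc i = k then 0 else Suc i in st (f j))" if "i < k" for i
  proof -
    have "st (f (Suc i)) = en (f i)"
      using \<pi>(2)[OF fE] by (simp add: f_Suc)
    moreover have "f (Suc i) = f 0" if "Suc i = k"
      using k that by (simp add: f_def)
    ultimately show ?thesis
      by (auto simp: Let_def)
  qed
  moreover have "inj_on (\<lambda>i. st (f i)) {..<k}"
    using inj st_inj[OF fE fE] by (auto simp: inj_on_def)
  ultimately show ?thesis
    using that[of k f] \<open>2 \<le> k\<close> inj fE unfolding st_def en_def E_def by simp
qed

text \<open>
  Edges run from sources to sinks, so an alternating cycle becomes a closed curve if its
  \<open>a\<close>-edges are traversed forwards and its \<open>b\<close>-edges backwards.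
\<close>

lemma bicolored_cycle_jordan:
  assumes c: "coloring w c" and cyc: "bicolored_cycle w c u C"
    and ab: "a \<noteq> b" "a \<noteq> u" "b \<noteq> u"
  obtains P where "simple_path P" "pathfinish P = pathstart P"
    "path_image P = (\<Union>x\<in>C. path_image (strand_curve w x))"
    "\<And>z. z \<notin> path_image P \<Longrightarrow> winding_number P z =
       (\<Sum>x\<in>C. (if c x = a then 1 else -1) * winding_number (strand_curve w x) z)"
proof (cases "\<exists>e. Inl e \<in> C")
  case True
  then obtain e where "Inl e \<in> C"
    by blast
  then obtain k f where k: "2 \<le> (k::nat)" "C = Inl ` f ` {..<k}" "inj_on f {..<k}"
    and f: "\<And>i. i < k \<Longrightarrow> f i \<in> es"
    and next_edge: "\<And>i. i < k \<Longrightarrow> (if c (Inl (f i)) = a then hd_of (f i) else tl_of (f i)) =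
       (let j = if Suc i = k then 0 else Suc i
        in if c (Inl (f j)) = a then tl_of (f j) else hd_of (f j))"
    and inj: "inj_on (\<lambda>i. if c (Inl (f i)) = a then tl_of (f i) else hd_of (f i)) {..<k}"
    by (rule edge_component_arcs[OF c cyc _ ab]) blast
  define g where "g i = (if c (Inl (f i)) = a then edge_curve w (f i)
      else reversepath (edge_curve w (f i)))" for i
  \<comment> \<open>Index \<open>k\<close> is sent to \<open>0\<close>, so the chain of vertices
    closes up by definition.\<close>
  define v where "v i = (let j = if i = k then 0 else i
      in if c (Inl (f j)) = a then tl_of (f j) else hd_of (f j))" for i
  have ends: "pathstart (g i) = v i" "pathfinish (g i) = v (Suc i)" if "i < k" for i
    using that f[of i] next_edge[of i] by (auto simp: g_def v_def Let_def)
  have img: "path_image (g i) = path_image (strand_curve w (Inl (f i)))" for i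
    by (simp add: g_def)
  have vset: "{v i, v (Suc i)} = {tl_of (f i), hd_of (f i)}" if "i < k" for i
    unfolding ends[OF that, symmetric] using f[OF that] by (auto simp: g_def)
  have arc: "arc (g i)" if "i < k" for i
    using arc_edge_curve[OF f[OF that]] by (simp add: g_def arc_reversepath)
  have inj_v: "inj_on v {..<k}"
    using inj by (simp add: v_def inj_on_def)
  have meet: "path_image (g i) \<inter> path_image (g j) \<subseteq> {v i, v (Suc i)} \<inter> {v j, v (Suc j)}"
    if "i < j" "j < k" for i j
  proof
    fix p assume "p \<in> path_image (g i) \<inter> path_image (g j)"
    moreover have "Inl (f i) \<in> strands w" "Inl (f j) \<in> strands w" "Inl (f i) \<noteq> Inl (f j)"
      using that f inj_onD[OF k(3), of i j] by auto
    ultimately show "p \<in> {v i, v (Suc i)} \<inter> {v j, v (Suc j)}"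
      using path_image_strands_Int[of "Inl (f i)" "Inl (f j)" p] vset that unfolding img by auto
  qed
  have loop: "v k = v 0"
    by (simp add: v_def)
  obtain P where P: "simple_path P" "pathfinish P = pathstart P"
    "path_image P = (\<Union>i<k. path_image (g i))"
    "\<And>z. z \<notin> path_image P \<Longrightarrow> winding_number P z = (\<Sum>i<k. winding_number (g i) z)"
    by (rule simple_closed_chain[OF k(1) arc ends loop inj_v meet]) (assumption+, rule that)
  have "winding_number P z =
      (\<Sum>x\<in>C. (if c x = a then 1 else -1) * winding_number (strand_curve w x) z)"
    if z: "z \<notin> path_image P" for z
  proof -
    have "winding_number (g i) z = (if c (Inl (f i)) = a then 1 else -1) *
        winding_number (strand_curve w (Inl (f i))) z" if "i < k" for i
    proof -
      have "z \<notin> path_image (edge_curve w (f i))"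
        using z that P(3) img[of i] by auto
      then show ?thesis
        using winding_number_reversepath[OF arc_imp_path[OF arc_edge_curve[OF f[OF that]]]]
        by (simp add: g_def)
    qed
    moreover have "inj_on (\<lambda>i. Inl (f i) :: 'e + 'o) {..<k}"
      using k(3) by (auto simp: inj_on_def)
    ultimately show ?thesis
      unfolding P(4)[OF z] k(2) image_image by (subst sum.reindex) auto
  qed
  then show ?thesis
    using that[OF P(1,2)] P(3) img k(2) by auto
next
  case False
  \<comment> \<open>A circle is adjacent to nothing, so a component without edges is one single
    circle, reversed below if its color is not \<open>a\<close>.\<close>
  obtain x where x: "x \<in> C" "C = (remaining_adjacency w c u)\<^sup>* `` {x}"
    using cyc unfolding bicolored_cycle_def by (auto elim: quotientE)
  then obtain m where m: "x = Inr m"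
    using False by (cases x) auto
  have "(x, y) \<in> (remaining_adjacency w c u)\<^sup>* \<Longrightarrow> y = x" for y
    by (induction rule: rtrancl_induct) (auto simp: m remaining_adjacency_def)
  then have C: "C = {Inr m}"
    using x m by auto
  have mw: "m \<in> circles w"
    using x(1) bicolored_cycle_subset[OF cyc] by (auto simp: m remaining_strands_def)
  note g = embedded_circle_simple[OF circle_embedded[OF mw]]
  show ?thesis
  proof (cases "c (Inr m) = a")
    case True
    then show ?thesis
      using that[of "circle_curve w m"] g C by simp
  next
    case False
    then show ?thesis
      using that[of "reversepath (circle_curve w m)"] g C
      by (simp add: simple_path_reversepath winding_number_reversepath simple_path_imp_path)
  qed
qed

end

section \<open>Height functions of colorings\<close>

definition web_image :: "('e, 'o) plane_web \<Rightarrow> complex set" where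
  "web_image w = (\<Union>x\<in>strands w. path_image (strand_curve w x))"

text \<open>
  The differences \<open>height w c a - height w c b\<close> are integers: they are the total winding
  numbers of the bicolored cycles with the colors \<open>a\<close> and \<open>b\<close>. Together they record a map from
  the faces of the web to the triangular lattice.
\<close>

definition height ::
    "('e, 'o) plane_web \<Rightarrow> ('e + 'o \<Rightarrow> web_color) \<Rightarrow> web_color \<Rightarrow> complex \<Rightarrow> complex" where
  "height w c a z = (\<Sum>x\<in>{x \<in> strands w. c x = a}. winding_number (strand_curve w x) z)"

context closed_web
begin

lemma finite_bicolored_cycles: "finite {C. bicolored_cycle w c u C}"
proof (rule finite_subset)
  show "{C. bicolored_cycle w c u C} \<subseteq> Pow (strands w)"
    using bicolored_cycle_subset[of w c u] by (auto simp: remaining_strands_def)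
qed simp

text \<open>Remaining strands that meet are adjacent and hence in the same component. At a vertex,
  the two remaining edges therefore belong to the same cycle.\<close>

lemma bicolored_cycles_images_disjoint:
  assumes "bicolored_cycle w c u C" "bicolored_cycle w c u D" "C \<noteq> D"
  shows "(\<Union>x\<in>C. path_image (strand_curve w x)) \<inter> (\<Union>x\<in>D. path_image (strand_curve w x)) = {}"
proof -
  have CD: "C \<inter> D = {}"
    using bicolored_cycle_disjoint assms by blast
  have "path_image (strand_curve w x) \<inter> path_image (strand_curve w y) = {}" if "x \<in> C" "y \<in> D" for x y
  proof (rule ccontr)
    assume "\<not> ?thesis"
    moreover have "x \<in> remaining_strands w c u" "y \<in> remaining_strands w c u" "x \<noteq> y"
      using that CD bicolored_cycle_subset assms(1,2) by blast+
    ultimately have "adjacent_strands w x y"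
      by (intro strands_meet_adjacent) (auto simp: remaining_strands_def)
    then show False
      using bicolored_cycle_closed[OF assms(1) that(1)] \<open>y \<in> remaining_strands w c u\<close> CD that(2) by auto
  qed
  then show ?thesis
    by blast
qed

lemma sum_remaining_strands:
  fixes h :: "'e + 'o \<Rightarrow> complex"
  shows "(\<Sum>x\<in>remaining_strands w c u. h x) = (\<Sum>C\<in>{C. bicolored_cycle w c u C}. \<Sum>x\<in>C. h x)"
proof -
  have "remaining_strands w c u = \<Union>{C. bicolored_cycle w c u C}"
    using bicolored_cycle_subset[of w c u] by (blast elim: bicolored_cycle_exists)
  moreover have "finite C" if "bicolored_cycle w c u C" for C
    using bicolored_cycle_subset[OF that]
    by (rule finite_subset) (auto simp: remaining_strands_def)
  ultimately show ?thesis
    using bicolored_cycle_disjoint[of w c u] by (simp add: sum.Union_disjoint)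
qed

text \<open>Strands of color \<open>u\<close> drop out, and the signs are those with which the
  Jordan curve of a bicolored cycle traverses its strands.\<close>

lemma height_diff:
  assumes ab: "a \<noteq> b" "a \<noteq> u" "b \<noteq> u"
  shows "height w c a z - height w c b z =
    (\<Sum>x\<in>remaining_strands w c u. (if c x = a then 1 else -1) * winding_number (strand_curve w x) z)"
proof -
  have cb: "c x = b" if "x \<in> remaining_strands w c u" "c x \<noteq> a" for x
    using third_color[of b u a "c x"] that ab by (auto simp: remaining_strands_def)
  have 1: "{x \<in> strands w. c x = a} = {x \<in> remaining_strands w c u. c x = a}"
    using ab by (auto simp: remaining_strands_def)
  have 2: "{x \<in> strands w. c x = b} = {x \<in> remaining_strands w c u. \<not> c x = a}"
    using ab cb by (auto simp: remaining_strands_def)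
  have fin: "finite (remaining_strands w c u)"
    by (simp add: remaining_strands_def)
  have "(\<Sum>x\<in>remaining_strands w c u. (if c x = a then 1 else -1) * winding_number (strand_curve w x) z) =
      (\<Sum>x\<in>remaining_strands w c u. if c x = a then winding_number (strand_curve w x) z
        else - winding_number (strand_curve w x) z)"
    by (rule sum.cong) auto
  also have "\<dots> = height w c a z - height w c b z"
    unfolding height_def 1 2 using fin
    by (simp add: sum.If_cases Int_def Collect_conj_eq[symmetric] sum_negf)
  finally show ?thesis ..
qed

text \<open>The right-hand side does not depend on the coloring. So if a fold preserves the height
  of \<open>u\<close>, it also preserves the sum of the two other heights.\<close>

lemma height_sum:
  assumes "a \<noteq> b" "a \<noteq> u" "b \<noteq> u"
  shows "height w c a z + height w c b z + height w c u z =
    (\<Sum>x\<in>strands w. winding_number (strand_curve w x) z)"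
proof -
  have eq: "strands w = {x \<in> strands w. c x = a} \<union> {x \<in> strands w. c x = b} \<union> {x \<in> strands w. c x = u}"
    using third_color[of b u a] assms by blast
  show ?thesis
    unfolding height_def using assms
    by (subst (4) eq, subst sum.union_disjoint, simp, simp, blast)
      (subst sum.union_disjoint; auto)
qed

lemma bicolored_cycle_curves:
  assumes c: "coloring w c" and ab: "a \<noteq> b" "a \<noteq> u" "b \<noteq> u"
  obtains P where "\<And>C. bicolored_cycle w c u C \<Longrightarrow> simple_path (P C)"
    "\<And>C. bicolored_cycle w c u C \<Longrightarrow> pathfinish (P C) = pathstart (P C)"
    "\<And>C. bicolored_cycle w c u C \<Longrightarrow> path_image (P C) = (\<Union>x\<in>C. path_image (strand_curve w x))"
    "\<And>C z. bicolored_cycle w c u C \<Longrightarrow> z \<notin> path_image (P C) \<Longrightarrow> winding_number (P C) z =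
       (\<Sum>x\<in>C. (if c x = a then 1 else -1) * winding_number (strand_curve w x) z)"
proof -
  have "\<exists>p. simple_path p \<and> pathfinish p = pathstart p \<and>
      path_image p = (\<Union>x\<in>C. path_image (strand_curve w x)) \<and>
      (\<forall>z. z \<notin> path_image p \<longrightarrow> winding_number p z =
        (\<Sum>x\<in>C. (if c x = a then 1 else -1) * winding_number (strand_curve w x) z))"
    if cyc: "bicolored_cycle w c u C" for C
  proof -
    obtain p where p: "simple_path p" "pathfinish p = pathstart p"
      "path_image p = (\<Union>x\<in>C. path_image (strand_curve w x))"
      "\<And>z. z \<notin> path_image p \<Longrightarrow> winding_number p z =
        (\<Sum>x\<in>C. (if c x = a then 1 else -1) * winding_number (strand_curve w x) z)"
      by (rule bicolored_cycle_jordan[OF c cyc ab]) (rule that)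
    then show ?thesis
      by (intro exI[of _ p] conjI allI impI)
  qed
  then have "\<forall>C\<in>{C. bicolored_cycle w c u C}. \<exists>p. simple_path p \<and> pathfinish p = pathstart p \<and>
      path_image p = (\<Union>x\<in>C. path_image (strand_curve w x)) \<and>
      (\<forall>z. z \<notin> path_image p \<longrightarrow> winding_number p z =
        (\<Sum>x\<in>C. (if c x = a then 1 else -1) * winding_number (strand_curve w x) z))"
    by blast
  from bchoice[OF this] obtain P where P: "\<forall>C\<in>{C. bicolored_cycle w c u C}.
      simple_path (P C) \<and> pathfinish (P C) = pathstart (P C) \<and>
      path_image (P C) = (\<Union>x\<in>C. path_image (strand_curve w x)) \<and>
      (\<forall>z. z \<notin> path_image (P C) \<longrightarrow> winding_number (P C) z =
        (\<Sum>x\<in>C. (if c x = a then 1 else -1) * winding_number (strand_curve w x) z))"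
    by blast
  show ?thesis
    by (rule that[of P]) (use P in blast)+
qed

text \<open>A Kempe change on \<open>C\<close> flips the sign of every strand of \<open>C\<close>
  and so negates the contribution of its curve to the height difference. Changing exactly the cycles
  with \<open>\<sigma> C = -1\<close> turns the difference into the sum with the prescribed
  orientations. Strands of color \<open>u\<close> keep their color, hence the last
  conclusion.\<close>

lemma kempe_fold:
  assumes c: "coloring w c" and ab: "a \<noteq> b" "a \<noteq> u" "b \<noteq> u"
  obtains c' where "(kempe_step w)\<^sup>*\<^sup>* c c'"
    "\<And>z. z \<notin> web_image w \<Longrightarrow> height w c' a z - height w c' b z \<in> {0, 1}"
    "\<And>z. height w c' u z = height w c u z"
proof -
  obtain P where P: "\<And>C. bicolored_cycle w c u C \<Longrightarrow> simple_path (P C)"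
    "\<And>C. bicolored_cycle w c u C \<Longrightarrow> pathfinish (P C) = pathstart (P C)"
    "\<And>C. bicolored_cycle w c u C \<Longrightarrow> path_image (P C) = (\<Union>x\<in>C. path_image (strand_curve w x))"
    "\<And>C z. bicolored_cycle w c u C \<Longrightarrow> z \<notin> path_image (P C) \<Longrightarrow> winding_number (P C) z =
       (\<Sum>x\<in>C. (if c x = a then 1 else -1) * winding_number (strand_curve w x) z)"
    by (rule bicolored_cycle_curves[OF c ab]) (rule that)
  define I where "I = {C. bicolored_cycle w c u C}"
  have sub: "C \<subseteq> remaining_strands w c u" if "C \<in> I" for C
    using bicolored_cycle_subset[of w c u C] that by (simp add: I_def)
  obtain \<sigma> :: "('e + 'o) set \<Rightarrow> int" where \<sigma>: "\<And>C. C \<in> I \<Longrightarrow> \<sigma> C = 1 \<or> \<sigma> C = -1"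
    "\<And>z. (\<And>C. C \<in> I \<Longrightarrow> z \<notin> path_image (P C)) \<Longrightarrow>
       (\<Sum>C\<in>I. of_int (\<sigma> C) * winding_number (P C) z) \<in> {0, 1}"
  proof (rule disjoint_jordan_curves_orientation)
    show "finite I"
      unfolding I_def by (rule finite_bicolored_cycles)
    show "path_image (P C) \<inter> path_image (P D) = {}" if "C \<in> I" "D \<in> I" "C \<noteq> D" for C D
      using that bicolored_cycles_images_disjoint[of c u C D] P(3) by (simp add: I_def)
  qed (use P(1,2) in \<open>auto simp: I_def\<close>)
  define F where "F = {C \<in> I. \<sigma> C = -1}"
  define c' where "c' = kempe_change u (\<Union>F) c"
  have rem: "remaining_strands w c' u = remaining_strands w c u"
    unfolding c'_def using sub by (intro remaining_strands_kempe_change) (auto simp: F_def)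
  have "(kempe_step w)\<^sup>*\<^sup>* c c'"
    unfolding c'_def F_def I_def using finite_bicolored_cycles
    by (intro kempe_equivalent_Union[OF c]) auto
  moreover have "height w c' u z = height w c u z" for z
  proof -
    have "{x \<in> strands w. c' x = u} = strands w - remaining_strands w c' u"
      "{x \<in> strands w. c x = u} = strands w - remaining_strands w c u"
      by (auto simp: remaining_strands_def)
    then show ?thesis
      unfolding height_def rem by simp
  qed
  moreover have "height w c' a z - height w c' b z \<in> {0, 1}" if z: "z \<notin> web_image w" for z
  proof -
    have sign: "(if c' x = a then 1 else -1) = of_int (\<sigma> C) * (if c x = a then 1 else -1 :: complex)"
      if "C \<in> I" "x \<in> C" for C x
    proof (cases "C \<in> F")
      case True
      have "c x \<noteq> u"
        using sub that by (auto simp: remaining_strands_def)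
      then have "c x = a \<or> c x = b"
        using third_color[of b u a "c x"] ab by auto
      moreover have "c' x = other_color u (c x)"
        using True that by (auto simp: c'_def kempe_change_eq)
      ultimately have "c' x = a \<longleftrightarrow> c x \<noteq> a"
        using other_color_eq[of a u b] other_color_eq[of b u a] ab by auto
      then show ?thesis
        using True by (simp add: F_def)
    next
      case False
      have "x \<notin> \<Union>F"
      proof
        assume "x \<in> \<Union>F"
        then obtain D where "D \<in> F" "x \<in> D"
          by blast
        then show False
          using False that bicolored_cycle_disjoint[of w c u C D] by (auto simp: F_def I_def)
      qed
      moreover have "\<sigma> C = 1"
        using False that \<sigma>(1) by (auto simp: F_def)
      ultimately show ?thesis
        by (simp add: c'_def kempe_change_eq)
    qed
    have off: "z \<notin> path_image (P C)" if "C \<in> I" for C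
      using P(3)[of C] z sub[OF that] that
      by (auto simp: I_def web_image_def remaining_strands_def)
    have "height w c' a z - height w c' b z = (\<Sum>x\<in>remaining_strands w c u.
        (if c' x = a then 1 else -1) * winding_number (strand_curve w x) z)"
      using height_diff[OF ab] rem by simp
    also have "\<dots> = (\<Sum>C\<in>I. \<Sum>x\<in>C. (if c' x = a then 1 else -1) * winding_number (strand_curve w x) z)"
      unfolding I_def by (rule sum_remaining_strands)
    also have "\<dots> = (\<Sum>C\<in>I. of_int (\<sigma> C) * winding_number (P C) z)"
    proof (rule sum.cong[OF refl])
      fix C assume "C \<in> I"
      have "(\<Sum>x\<in>C. (if c' x = a then 1 else -1) * winding_number (strand_curve w x) z) =
          (\<Sum>x\<in>C. of_int (\<sigma> C) * ((if c x = a then 1 else -1) * winding_number (strand_curve w x) z))"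
        using sign[OF \<open>C \<in> I\<close>] by (intro sum.cong[OF refl]) (simp only: mult.assoc)
      also have "\<dots> = of_int (\<sigma> C) * winding_number (P C) z"
        using P(4)[OF _ off[OF \<open>C \<in> I\<close>]] \<open>C \<in> I\<close> by (simp add: I_def sum_distrib_left)
      finally show "(\<Sum>x\<in>C. (if c' x = a then 1 else -1) * winding_number (strand_curve w x) z) =
          of_int (\<sigma> C) * winding_number (P C) z" .
    qed
    finally show ?thesis
      using \<sigma>(2)[OF off] by simp
  qed
  ultimately show ?thesis
    using that by blast
qed

text \<open>For the third color \<open>u\<close>, only the bicolored cycle through \<open>x\<close>
  meets \<open>B\<close>, so \<open>winding_number_jump\<close> applies. The two points witness that
  the color of \<open>x\<close> is \<open>a\<close>: they will be sample points at which a coloring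
  that differs at \<open>x\<close> is detected.\<close>

lemma height_jump:
  assumes c: "coloring w c" and x: "x \<in> strands w" "c x = a" and "a \<noteq> b"
    and B: "open B" "connected B" "q \<in> B" "q \<in> path_image (strand_curve w x)"
    and off: "\<And>y. y \<in> strands w \<Longrightarrow> y \<noteq> x \<Longrightarrow> path_image (strand_curve w y) \<inter> B = {}"
  obtains z1 z2 where "z1 \<in> B - web_image w" "z2 \<in> B - web_image w"
    "height w c a z1 - height w c b z1 \<noteq> height w c a z2 - height w c b z2"
proof -
  obtain u where "u \<noteq> a" "u \<noteq> b"
    by (rule third_color_exists)
  then have ab: "a \<noteq> b" "a \<noteq> u" "b \<noteq> u"
    using \<open>a \<noteq> b\<close> by simp_all
  obtain P where P: "\<And>C. bicolored_cycle w c u C \<Longrightarrow> simple_path (P C)"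
    "\<And>C. bicolored_cycle w c u C \<Longrightarrow> pathfinish (P C) = pathstart (P C)"
    "\<And>C. bicolored_cycle w c u C \<Longrightarrow> path_image (P C) = (\<Union>x\<in>C. path_image (strand_curve w x))"
    "\<And>C z. bicolored_cycle w c u C \<Longrightarrow> z \<notin> path_image (P C) \<Longrightarrow> winding_number (P C) z =
       (\<Sum>x\<in>C. (if c x = a then 1 else -1) * winding_number (strand_curve w x) z)"
    by (rule bicolored_cycle_curves[OF c ab]) (rule that)
  define I where "I = {C. bicolored_cycle w c u C}"
  have sub: "C \<subseteq> remaining_strands w c u" if "C \<in> I" for C
    using bicolored_cycle_subset[of w c u C] that by (simp add: I_def)
  have "x \<in> remaining_strands w c u"
    using x ab by (simp add: remaining_strands_def)
  then obtain C where C: "C \<in> I" "x \<in> C"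
    using bicolored_cycle_exists[of x w c u] unfolding I_def by blast
  have other: "path_image (P D) \<inter> B = {}" if "D \<in> I" "D \<noteq> C" for D
  proof -
    have "x \<notin> D"
      using bicolored_cycle_disjoint[of w c u C D] that C by (auto simp: I_def)
    then have "path_image (strand_curve w y) \<inter> B = {}" if "y \<in> D" for y
      using off[of y] sub[OF \<open>D \<in> I\<close>] that by (auto simp: remaining_strands_def)
    moreover have "path_image (P D) = (\<Union>y\<in>D. path_image (strand_curve w y))"
      using P(3)[of D] that by (simp add: I_def)
    ultimately show ?thesis
      by auto
  qed
  have img: "path_image (strand_curve w x) \<subseteq> path_image (P C)"
    using P(3) C by (auto simp: I_def)
  obtain z1 z2 where z: "z1 \<in> B" "z2 \<in> B" "z1 \<notin> path_image (P C)" "z2 \<notin> path_image (P C)"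
    "(\<Sum>D\<in>I. winding_number (P D) z1) \<noteq> (\<Sum>D\<in>I. winding_number (P D) z2)"
  proof (rule winding_number_jump)
    show "finite I"
      unfolding I_def by (rule finite_bicolored_cycles)
    show "C \<in> I" "open B" "connected B" "q \<in> B" "q \<in> path_image (P C)"
      using C B img by auto
  qed (use P(1,2) other in \<open>auto simp: I_def\<close>)
  have web: "z \<notin> web_image w" if "z \<in> B" "z \<notin> path_image (P C)" for z
    using that off img unfolding web_image_def by blast
  have "height w c a z - height w c b z = (\<Sum>D\<in>I. winding_number (P D) z)"
    if z: "z \<in> B" "z \<notin> path_image (P C)" for z
  proof -
    have "z \<notin> path_image (P D)" if "D \<in> I" for D
      using other[OF that] z by (cases "D = C") auto
    then show ?thesis
      unfolding height_diff[OF ab] sum_remaining_strands using P(4)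
      by (intro sum.cong) (auto simp: I_def)
  qed
  then show ?thesis
    using that[of z1 z2] z web by simp
qed

end

section \<open>Integrality\<close>

lemma exp_2pi_i_eq_imp_diff_Ints:
  assumes "exp (2 * of_real pi * \<i> * x) = exp (2 * of_real pi * \<i> * y)"
  shows "x - y \<in> \<int>"
proof -
  obtain n :: int where "2 * of_real pi * \<i> * x = 2 * of_real pi * \<i> * y + of_int (2 * n) * (of_real pi * \<i>)"
    using assms by (auto simp: exp_eq mult.assoc)
  then have "2 * of_real pi * \<i> * (x - y) = 2 * of_real pi * \<i> * of_int n"
    by (simp add: algebra_simps)
  then have "x - y = of_int n"
    by simp
  then show ?thesis
    by simp
qed

lemma continuous_on_Ints_constant:
  fixes g :: "complex \<Rightarrow> complex"
  assumes "connected B" "continuous_on B g" "\<And>z. z \<in> B \<Longrightarrow> g z \<in> \<int>"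
    and "z1 \<in> B" "z2 \<in> B"
  shows "g z1 = g z2"
proof -
  have "\<exists>e>0. \<forall>y. y \<in> B \<and> g y \<noteq> g x \<longrightarrow> e \<le> norm (g y - g x)" if x: "x \<in> B" for x
  proof (intro exI[of _ 1] conjI allI impI)
    fix y assume y: "y \<in> B \<and> g y \<noteq> g x"
    then obtain m where m: "g y - g x = of_int m"
      using Ints_diff[OF assms(3)[of y] assms(3)[of x]] x by (auto elim: Ints_cases)
    then have "m \<noteq> 0"
      using y by auto
    then show "1 \<le> norm (g y - g x)"
      using m by simp
  qed simp
  then have "g constant_on B"
    using assms by (intro continuous_discrete_range_constant) auto
  then show ?thesis
    using assms(4,5) by (auto simp: constant_on_def)
qed

context closed_web
begin

text \<open>
  The value of \<open>exp (2 * pi * \<i> * winding_number (strand_curve w x) z)\<close>, also meaningful for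
  \<open>z\<close> on the strand.
\<close>

definition ratio :: "complex \<Rightarrow> 'e + 'o \<Rightarrow> complex" where
  "ratio z x = (case x of Inl e \<Rightarrow> (hd_of e - z) / (tl_of e - z) | Inr k \<Rightarrow> 1)"

lemma exp_winding_number:
  assumes x: "x \<in> strands w" and z: "z \<notin> path_image (strand_curve w x)"
  shows "exp (2 * of_real pi * \<i> * winding_number (strand_curve w x) z) = ratio z x"
proof -
  have eq: "pathfinish (strand_curve w x) - z =
      exp (2 * of_real pi * \<i> * winding_number (strand_curve w x) z) * (pathstart (strand_curve w x) - z)"
    using winding_number_exp_2pi[OF path_strand_curve[OF x] z] by simp
  have ne: "pathstart (strand_curve w x) - z \<noteq> 0"
    using z pathstart_in_path_image[of "strand_curve w x"] by auto
  show ?thesis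
  proof (cases x)
    case (Inl e)
    then show ?thesis
      using eq ne x by (simp add: ratio_def field_simps)
  next
    case (Inr k)
    then have "pathfinish (strand_curve w x) = pathstart (strand_curve w x)"
      using x embedded_circle_simple(2)[OF circle_embedded] by simp
    then show ?thesis
      using eq ne Inr by (simp add: ratio_def)
  qed
qed

text \<open>
  Every color class is a perfect matching, so the heads of its edges are all the sinks and the
  tails are all the sources.
\<close>

lemma prod_ratio:
  assumes c: "coloring w c"
  shows "(\<Prod>x\<in>{x \<in> strands w. c x = a}. ratio z x) = (\<Prod>v\<in>hd_of ` es. v - z) / (\<Prod>v\<in>tl_of ` es. v - z)"
proof -
  define M where "M = {e \<in> es. c (Inl e) = a}"
  define K where "K = {k \<in> circles w. c (Inr k) = a}"
  have fin: "finite M" "finite K"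
    using finite_circles by (auto simp: M_def K_def)
  have split: "{x \<in> strands w. c x = a} = Inl ` M \<union> Inr ` K"
    by (auto simp: M_def K_def strands_def)
  have inj: "inj_on hd_of M" "inj_on tl_of M"
    using colored_edge_unique[OF c] by (auto simp: inj_on_def M_def)
  have img: "hd_of ` M = hd_of ` es" "tl_of ` M = tl_of ` es"
  proof -
    show "hd_of ` M = hd_of ` es"
    proof
      show "hd_of ` es \<subseteq> hd_of ` M"
      proof
        fix v assume "v \<in> hd_of ` es"
        then obtain e where e: "e \<in> es" "v = hd_of e" by blast
        then obtain f where f: "f \<in> es" "v \<in> {tl_of f, hd_of f}" "c (Inl f) = a"
          using colored_edge_exists[OF c, of v a] by auto
        then have "v = hd_of f"
          using e tail_neq_head[of f e] by auto
        then show "v \<in> hd_of ` M"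
          using f by (auto simp: M_def)
      qed
    qed (auto simp: M_def)
    show "tl_of ` M = tl_of ` es"
    proof
      show "tl_of ` es \<subseteq> tl_of ` M"
      proof
        fix v assume "v \<in> tl_of ` es"
        then obtain e where e: "e \<in> es" "v = tl_of e" by blast
        then obtain f where f: "f \<in> es" "v \<in> {tl_of f, hd_of f}" "c (Inl f) = a"
          using colored_edge_exists[OF c, of v a] by auto
        then have "v = tl_of f"
          using e tail_neq_head[of e f] by auto
        then show "v \<in> tl_of ` M"
          using f by (auto simp: M_def)
      qed
    qed (auto simp: M_def)
  qed
  have "(\<Prod>x\<in>{x \<in> strands w. c x = a}. ratio z x) = (\<Prod>x\<in>Inl ` M. ratio z x) * (\<Prod>x\<in>Inr ` K. ratio z x)"
    unfolding split using fin by (intro prod.union_disjoint) auto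
  also have "(\<Prod>x\<in>Inr ` K. ratio z x) = 1"
    by (rule prod.neutral) (auto simp: ratio_def)
  also have "(\<Prod>x\<in>Inl ` M. ratio z x) = (\<Prod>e\<in>M. (hd_of e - z) / (tl_of e - z))"
    by (subst prod.reindex) (auto simp: ratio_def)
  also have "\<dots> = (\<Prod>e\<in>M. hd_of e - z) / (\<Prod>e\<in>M. tl_of e - z)"
    by (rule prod_dividef)
  also have "(\<Prod>e\<in>M. hd_of e - z) = (\<Prod>v\<in>hd_of ` es. v - z)"
    unfolding img(1)[symmetric] by (subst prod.reindex[OF inj(1)]) simp
  also have "(\<Prod>e\<in>M. tl_of e - z) = (\<Prod>v\<in>tl_of ` es. v - z)"
    unfolding img(2)[symmetric] by (subst prod.reindex[OF inj(2)]) simp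
  finally show ?thesis
    by simp
qed

lemma exp_sum_winding_number:
  assumes "finite M" "M \<subseteq> strands w" "\<And>x. x \<in> M \<Longrightarrow> z \<notin> path_image (strand_curve w x)"
  shows "exp (2 * of_real pi * \<i> * (\<Sum>x\<in>M. winding_number (strand_curve w x) z)) = (\<Prod>x\<in>M. ratio z x)"
  unfolding sum_distrib_left exp_sum[OF assms(1)]
  using assms by (intro prod.cong[OF refl] exp_winding_number) auto

text \<open>By \<open>prod_ratio\<close> both exponentials equal the quotient of the products over
  all sinks and all sources, in which neither colors nor colorings occur. With \<open>c = c'\<close>
  this gives integer coordinates; with \<open>a = b\<close> it compares two colorings.\<close>

lemma height_diff_Ints:
  assumes "coloring w c" "coloring w c'" "z \<notin> web_image w"
  shows "height w c a z - height w c' b z \<in> \<int>"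
proof (rule exp_2pi_i_eq_imp_diff_Ints)
  have "exp (2 * of_real pi * \<i> * height w d e z) = (\<Prod>x\<in>{x \<in> strands w. d x = e}. ratio z x)" for d e
    unfolding height_def using assms(3) by (intro exp_sum_winding_number) (auto simp: web_image_def)
  then show "exp (2 * of_real pi * \<i> * height w c a z) = exp (2 * of_real pi * \<i> * height w c' b z)"
    using prod_ratio assms(1,2) by simp
qed

section \<open>Comparing two colorings across one strand\<close>

text \<open>Strand \<open>x\<close> contributes to both heights and cancels. What is left is
  continuous on \<open>B\<close>, even across \<open>x\<close>, and it is integer valued by
  comparing exponentials; on a connected set it is therefore constant.\<close>

lemma height_diff_const_across:
  assumes c: "coloring w c" "coloring w c'" and x: "x \<in> strands w" "c x = a" "c' x = b"
    and B: "connected B" "B \<inter> vs = {}"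
    and off: "\<And>y. y \<in> strands w \<Longrightarrow> y \<noteq> x \<Longrightarrow> path_image (strand_curve w y) \<inter> B = {}"
    and z: "z1 \<in> B" "z2 \<in> B"
  shows "height w c a z1 - height w c' b z1 = height w c a z2 - height w c' b z2"
proof -
  define M where "M = {y \<in> strands w. c y = a} - {x}"
  define M' where "M' = {y \<in> strands w. c' y = b} - {x}"
  have M: "{y \<in> strands w. c y = a} = insert x M" "x \<notin> M" "finite M" "M \<subseteq> strands w"
    and M': "{y \<in> strands w. c' y = b} = insert x M'" "x \<notin> M'" "finite M'" "M' \<subseteq> strands w"
    using x by (auto simp: M_def M'_def)
  define g where "g z = (\<Sum>y\<in>M. winding_number (strand_curve w y) z) -
      (\<Sum>y\<in>M'. winding_number (strand_curve w y) z)" for z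
  have g: "height w c a z - height w c' b z = g z" for z
    unfolding height_def M(1) M'(1) g_def using M M' by simp
  have cont: "continuous_on B (winding_number (strand_curve w y))" if "y \<in> strands w" "y \<noteq> x" for y
    using continuous_on_winding_number[OF path_strand_curve[OF that(1)]] off[OF that]
    by (elim continuous_on_subset) auto
  have "continuous_on B g"
    unfolding g_def using M M' by (intro continuous_intros cont) auto
  moreover have "g z \<in> \<int>" if "z \<in> B" for z
    unfolding g_def
  proof (rule exp_2pi_i_eq_imp_diff_Ints)
    \<comment> \<open>\<open>z\<close> may lie on \<open>x\<close> itself, where the winding number
      along \<open>x\<close> is not usable. Its factor \<open>ratio z x\<close> is still defined,
      and it can be cancelled because \<open>B\<close> contains no vertex.\<close>
    have ne: "ratio z x \<noteq> 0"
    proof (cases x)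
      case (Inl e)
      then have "tl_of e \<in> vs" "hd_of e \<in> vs"
        using x(1) by auto
      then have "tl_of e \<noteq> z" "hd_of e \<noteq> z"
        using B(2) that by auto
      then show ?thesis
        by (simp add: Inl ratio_def)
    qed (simp add: ratio_def)
    have "ratio z x * (\<Prod>y\<in>M. ratio z y) = ratio z x * (\<Prod>y\<in>M'. ratio z y)"
      using prod_ratio[OF c(1), where a = a and z = z] prod_ratio[OF c(2), where a = b and z = z]
      unfolding M(1) M'(1) using M M' by simp
    then have "(\<Prod>y\<in>M. ratio z y) = (\<Prod>y\<in>M'. ratio z y)"
      using ne by simp
    moreover have "exp (2 * of_real pi * \<i> * (\<Sum>y\<in>N. winding_number (strand_curve w y) z)) = (\<Prod>y\<in>N. ratio z y)"
      if "finite N" "N \<subseteq> strands w" "x \<notin> N" for N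
      using that off \<open>z \<in> B\<close> by (intro exp_sum_winding_number) blast+
    ultimately show "exp (2 * of_real pi * \<i> * (\<Sum>y\<in>M. winding_number (strand_curve w y) z)) =
        exp (2 * of_real pi * \<i> * (\<Sum>y\<in>M'. winding_number (strand_curve w y) z))"
      using M M' by simp
  qed
  ultimately have "g z1 = g z2"
    using continuous_on_Ints_constant[OF B(1)] z by blast
  then show ?thesis
    by (simp add: g)
qed

text \<open>The vertices and the other strands form a closed set that misses the interior of
  \<open>x\<close>. In a small ball around an interior point, crossing \<open>x\<close> can be
  studied in isolation.\<close>

lemma strand_neighborhood:
  assumes x: "x \<in> strands w"
  obtains B q where "open B" "connected B" "q \<in> B" "q \<in> path_image (strand_curve w x)" "B \<inter> vs = {}"
    "\<And>y. y \<in> strands w \<Longrightarrow> y \<noteq> x \<Longrightarrow> path_image (strand_curve w y) \<inter> B = {}"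
proof -
  have "strand_image w x \<noteq> {}"
    by (cases x) auto
  then obtain q where q: "q \<in> strand_image w x"
    by blast
  define U where "U = - (vs \<union> (\<Union>y\<in>strands w - {x}. path_image (strand_curve w y)))"
  have "open U"
    unfolding U_def using path_strand_curve
    by (intro open_Compl closed_Un closed_UN finite_imp_closed) (auto intro: closed_path_image)
  moreover have "q \<in> U"
    using q strands_avoid_verts[OF x] strand_image_Int[OF x] by (auto simp: U_def)
  ultimately obtain e where e: "0 < e" "ball q e \<subseteq> U"
    using open_contains_ball by blast
  show ?thesis
  proof (rule that[of "ball q e" q])
    show "q \<in> path_image (strand_curve w x)"
      using q strand_image_subset[OF x] by blast
    show "ball q e \<inter> vs = {}"
      using e(2) by (auto simp: U_def)
    show "path_image (strand_curve w y) \<inter> ball q e = {}" if "y \<in> strands w" "y \<noteq> x" for y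
      using e(2) that by (auto simp: U_def)
  qed (use e(1) in auto)
qed

section \<open>Folding onto a triangle\<close>

text \<open>
  Up to a factor, the squared distance in the triangular lattice between the point with the
  coordinates \<open>r\<close>, \<open>s\<close>, \<open>r + s\<close> and the center \<open>(1/3, 1/3, 2/3)\<close> of the triangle on which
  all three coordinates lie in \<open>{0, 1}\<close>.
\<close>

definition energy :: "int \<Rightarrow> int \<Rightarrow> int" where
  "energy r s = (3 * r - 1)\<^sup>2 + (3 * s - 1)\<^sup>2 + (3 * (r + s) - 2)\<^sup>2"

lemma energy_nonneg: "0 \<le> energy r s"
  by (simp add: energy_def)

text \<open>With \<open>r + 2 * s\<close> fixed, the energy is a constant plus a multiple of the
  squared distance of \<open>r\<close> from \<open>1/3\<close>, and the parity of \<open>r\<close>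
  is fixed as well. Among the integers of one parity, the one in \<open>{0, 1}\<close> is the
  closest to \<open>1/3\<close>.\<close>

lemma energy_fold_1:
  assumes "r' \<in> {0, 1}" "r' + 2 * s' = r + 2 * s"
  shows "energy r' s' \<le> energy r s" "r \<notin> {0, 1} \<Longrightarrow> energy r' s' < energy r s"
proof -
  define m where "m = s' - s"
  have rs: "r = r' + 2 * m" "s = s' - m"
    using assms(2) by (auto simp: m_def)
  have diff: "energy r s = energy r' s' + 18 * (m * (3 * r' + 3 * m - 1))"
    unfolding energy_def rs by (simp add: power2_eq_square algebra_simps)
  have pos: "0 < m * (3 * r' + 3 * m - 1)" if "m \<noteq> 0"
    using assms(1) that unfolding zero_less_mult_iff insert_iff empty_iff by presburger
  show "energy r' s' \<le> energy r s"
    using diff pos by (cases "m = 0") auto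
  assume "r \<notin> {0, 1}"
  then have "m \<noteq> 0"
    using rs assms(1) by auto
  then show "energy r' s' < energy r s"
    using diff pos by simp
qed

lemma energy_commute: "energy r s = energy s r"
  by (simp add: energy_def algebra_simps)

text \<open>The same for the third coordinate \<open>r + s\<close>, with \<open>r - s\<close> fixed:
  among the integers of one parity, the one in \<open>{0, 1}\<close> is the closest to
  \<open>2/3\<close>.\<close>

lemma energy_fold_2:
  assumes "r' + s' \<in> {0, 1}" "r' - s' = r - s"
  shows "energy r' s' \<le> energy r s" "r + s \<notin> {0, 1} \<Longrightarrow> energy r' s' < energy r s"
proof -
  define m where "m = r - r'"
  define t where "t = r' + s'"
  have rs: "r = r' + m" "s = s' + m" "s' = t - r'"
    using assms(2) by (auto simp: m_def t_def)
  have diff: "energy r s = energy r' s' + 18 * (m * (3 * t + 3 * m - 2))"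
    unfolding energy_def rs by (simp add: power2_eq_square algebra_simps)
  have pos: "0 < m * (3 * t + 3 * m - 2)" if "m \<noteq> 0"
  proof -
    have "t = 0 \<or> t = 1"
      using assms(1) by (simp add: t_def)
    then show ?thesis
      using that by (auto simp: zero_less_mult_iff; presburger)
  qed
  show "energy r' s' \<le> energy r s"
    using diff pos by (cases "m = 0") auto
  assume "r + s \<notin> {0, 1}"
  then have "m \<noteq> 0"
    using rs(1,2) assms(1) by auto
  then show "energy r' s' < energy r s"
    using diff pos by simp
qed

text \<open>An integer version of the coordinates, so that the energy can be minimized. It agrees
  with the height difference for colorings and points off the web; elsewhere the value has no
  meaning.\<close>

definition height_diff_int :: "('e + 'o \<Rightarrow> web_color) \<Rightarrow> web_color \<Rightarrow> web_color \<Rightarrow> complex \<Rightarrow> int" where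
  "height_diff_int c a b z = \<lfloor>Re (height w c a z - height w c b z)\<rfloor>"

lemma of_int_height_diff_int:
  assumes "coloring w c" "z \<notin> web_image w"
  shows "of_int (height_diff_int c a b z) = height w c a z - height w c b z"
proof -
  obtain n where "height w c a z - height w c b z = of_int n"
    using height_diff_Ints[OF assms(1,1,2)] Ints_cases by metis
  then show ?thesis
    by (simp add: height_diff_int_def)
qed

text \<open>Take a coloring of least total energy in the Kempe class. A fold acts on all points of
  \<open>Z\<close> at once, increases none of the summands, and strictly decreases those whose
  folded coordinate was outside \<open>{0, 1}\<close>; by minimality there are none.\<close>

lemma kempe_minimal:
  assumes c: "coloring w c" and Z: "finite Z" "Z \<inter> web_image w = {}"
  obtains c' where "(kempe_step w)\<^sup>*\<^sup>* c c'"
    "\<And>z. z \<in> Z \<Longrightarrow> height_diff_int c' Red Green z \<in> {0, 1} \<and> height_diff_int c' Green Blue z \<in> {0, 1} \<and>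
       height_diff_int c' Red Green z + height_diff_int c' Green Blue z \<in> {0, 1}"
proof -
  define en where "en d z = energy (height_diff_int d Red Green z) (height_diff_int d Green Blue z)" for d z
  define \<Phi> where "\<Phi> d = (\<Sum>z\<in>Z. en d z)" for d
  have \<Phi>_nonneg: "0 \<le> \<Phi> d" for d
    unfolding \<Phi>_def en_def by (intro sum_nonneg) (simp add: energy_nonneg)
  obtain c' where c': "(kempe_step w)\<^sup>*\<^sup>* c c'"
      and min: "\<And>d. (kempe_step w)\<^sup>*\<^sup>* c d \<Longrightarrow> nat (\<Phi> c') \<le> nat (\<Phi> d)"
    using ex_has_least_nat[of "(kempe_step w)\<^sup>*\<^sup>* c" c "\<lambda>d. nat (\<Phi> d)"] by blast
  have col: "coloring w c'"
    using kempe_equivalent_coloring[OF c' c] .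
  have int: "of_int (height_diff_int d a b z) = height w d a z - height w d b z"
    if "coloring w d" "z \<in> Z" for d a b z
    using of_int_height_diff_int[OF that(1)] that(2) Z(2) by blast
  \<comment> \<open>The argument common to the three pairs of colors; \<open>P z\<close> stands for
    the coordinate of the pair \<open>a\<close>, \<open>b\<close> at \<open>z\<close> lying in
    \<open>{0, 1}\<close>.\<close>
  have minimal: "P z" if "z \<in> Z"
    and ab: "a \<noteq> b" "a \<noteq> u" "b \<noteq> u"
    and le: "\<And>d z. coloring w d \<Longrightarrow> z \<in> Z \<Longrightarrow> height w d a z - height w d b z \<in> {0, 1} \<Longrightarrow>
      height w d u z = height w c' u z \<Longrightarrow>
      height w d a z + height w d b z = height w c' a z + height w c' b z \<Longrightarrow>
      en d z \<le> en c' z \<and> (\<not> P z \<longrightarrow> en d z < en c' z)"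
    for P z a b u
  proof (rule ccontr)
    assume neg: "\<not> P z"
    obtain d where d: "(kempe_step w)\<^sup>*\<^sup>* c' d"
      "\<And>z. z \<notin> web_image w \<Longrightarrow> height w d a z - height w d b z \<in> {0, 1}"
      "\<And>z. height w d u z = height w c' u z"
      by (rule kempe_fold[OF col ab]) (rule that)
    have cd: "coloring w d"
      using kempe_equivalent_coloring[OF d(1) col] .
    have "height w d a y + height w d b y = height w c' a y + height w c' b y" for y
      using height_sum[OF ab, of d y] height_sum[OF ab, of c' y] d(3)[of y]
      by (metis add_right_cancel)
    then have *: "en d y \<le> en c' y" "\<not> P y \<Longrightarrow> en d y < en c' y" if "y \<in> Z" for y
      using le[OF cd that] d(2)[of y] d(3)[of y] that Z(2) by blast+
    have "\<Phi> d < \<Phi> c'"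
      unfolding \<Phi>_def using Z(1) * \<open>z \<in> Z\<close> neg by (intro sum_strict_mono_ex1) auto
    then have "nat (\<Phi> d) < nat (\<Phi> c')"
      using \<Phi>_nonneg[of d] by simp
    moreover have "(kempe_step w)\<^sup>*\<^sup>* c d"
      using c' d(1) by simp
    ultimately show False
      using min[of d] leD by blast
  qed
  have of_int_01: "n \<in> {0, 1}" if "(of_int n :: complex) \<in> {0, 1}" for n
    using that by (metis insert_iff of_int_0_eq_iff of_int_eq_1_iff singletonD)
  have of_int_eq: "m = n" if "(of_int m :: complex) = of_int n" for m n
    using that by simp
  have RG: "height_diff_int c' Red Green z \<in> {0, 1}" if "z \<in> Z" for z
  proof (rule minimal[OF that, of Red Green Blue])
    fix d y assume d: "coloring w d" "y \<in> Z" "height w d Red y - height w d Green y \<in> {0, 1}"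
      "height w d Blue y = height w c' Blue y"
      "height w d Red y + height w d Green y = height w c' Red y + height w c' Green y"
    have "height_diff_int d Red Green y \<in> {0, 1}"
      using d(3) unfolding int[OF d(1,2), symmetric] by (rule of_int_01)
    \<comment> \<open>This combination is Red plus Green minus twice Blue in terms of heights, which
      the fold preserves. The other two pairs use the analogous combinations.\<close>
    moreover have "height_diff_int d Red Green y + 2 * height_diff_int d Green Blue y =
        height_diff_int c' Red Green y + 2 * height_diff_int c' Green Blue y"
      using d(4,5) by (intro of_int_eq) (simp add: int[OF d(1,2)] int[OF col d(2)] algebra_simps)
    ultimately show "en d y \<le> en c' y \<and> (height_diff_int c' Red Green y \<notin> {0, 1} \<longrightarrow> en d y < en c' y)"
      unfolding en_def using energy_fold_1 by blast
  qed auto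
  have GB: "height_diff_int c' Green Blue z \<in> {0, 1}" if "z \<in> Z" for z
  proof (rule minimal[OF that, of Green Blue Red])
    fix d y assume d: "coloring w d" "y \<in> Z" "height w d Green y - height w d Blue y \<in> {0, 1}"
      "height w d Red y = height w c' Red y"
      "height w d Green y + height w d Blue y = height w c' Green y + height w c' Blue y"
    have "height_diff_int d Green Blue y \<in> {0, 1}"
      using d(3) unfolding int[OF d(1,2), symmetric] by (rule of_int_01)
    moreover have "height_diff_int d Green Blue y + 2 * height_diff_int d Red Green y =
        height_diff_int c' Green Blue y + 2 * height_diff_int c' Red Green y"
      using d(4,5) by (intro of_int_eq) (simp add: int[OF d(1,2)] int[OF col d(2)] algebra_simps)
    ultimately show "en d y \<le> en c' y \<and> (height_diff_int c' Green Blue y \<notin> {0, 1} \<longrightarrow> en d y < en c' y)"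
      unfolding en_def energy_commute[of "height_diff_int _ Red Green y"] using energy_fold_1 by blast
  qed auto
  have RB: "height_diff_int c' Red Green z + height_diff_int c' Green Blue z \<in> {0, 1}" if "z \<in> Z" for z
  proof (rule minimal[OF that, of Red Blue Green])
    fix d y assume d: "coloring w d" "y \<in> Z" "height w d Red y - height w d Blue y \<in> {0, 1}"
      "height w d Green y = height w c' Green y"
      "height w d Red y + height w d Blue y = height w c' Red y + height w c' Blue y"
    have "height w d Red y - height w d Blue y =
        of_int (height_diff_int d Red Green y + height_diff_int d Green Blue y)"
      by (simp add: int[OF d(1,2)])
    then have "height_diff_int d Red Green y + height_diff_int d Green Blue y \<in> {0, 1}"
      using d(3) by (intro of_int_01) simp
    moreover have "height_diff_int d Red Green y - height_diff_int d Green Blue y =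
        height_diff_int c' Red Green y - height_diff_int c' Green Blue y"
      using d(4,5) by (intro of_int_eq) (simp add: int[OF d(1,2)] int[OF col d(2)] algebra_simps)
    ultimately show "en d y \<le> en c' y \<and>
        (height_diff_int c' Red Green y + height_diff_int c' Green Blue y \<notin> {0, 1} \<longrightarrow> en d y < en c' y)"
      unfolding en_def using energy_fold_2 by blast
  qed auto
  show ?thesis
    using that[OF c'] RG GB RB by blast
qed

section \<open>Uniqueness of the folded coloring\<close>

text \<open>The integers \<open>n a\<close> sum to zero, so \<open>n Red - n Green\<close> and
  \<open>n Green - n Blue\<close> are congruent modulo 3. They are the coordinate differences of two
  vertices of the triangle \<open>(0,0)\<close>, \<open>(1,0)\<close>, \<open>(0,1)\<close>, and for
  different vertices this congruence fails: the three vertices lie in the three different classes of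
  the root lattice.\<close>

lemma height_unique:
  assumes c: "coloring w c" "coloring w c'" and z: "z \<notin> web_image w"
    and "height_diff_int c Red Green z \<in> {0, 1}" "height_diff_int c Green Blue z \<in> {0, 1}"
      "height_diff_int c Red Green z + height_diff_int c Green Blue z \<in> {0, 1}"
    and "height_diff_int c' Red Green z \<in> {0, 1}" "height_diff_int c' Green Blue z \<in> {0, 1}"
      "height_diff_int c' Red Green z + height_diff_int c' Green Blue z \<in> {0, 1}"
  shows "height w c a z = height w c' a z"
proof -
  have "\<exists>n. height w c a z - height w c' a z = of_int n" for a
    using height_diff_Ints[OF c z] Ints_cases by metis
  then obtain n where n: "\<And>a. height w c a z - height w c' a z = of_int (n a)"
    by metis
  have of_int_eq: "m = k" if "(of_int m :: complex) = of_int k" for m k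
    using that by simp
  have sum: "n Red + n Green + n Blue = 0"
    using height_sum[of Red Green Blue c z] height_sum[of Red Green Blue c' z]
    by (intro of_int_eq) (simp flip: n add: algebra_simps)
  have "height_diff_int c a b z - height_diff_int c' a b z = n a - n b" for a b
    by (intro of_int_eq) (simp add: of_int_height_diff_int[OF c(1) z] of_int_height_diff_int[OF c(2) z] flip: n)
  from this[of Red Green] this[of Green Blue] have "n Red = 0 \<and> n Green = 0 \<and> n Blue = 0"
    using sum assms(4-9) by auto
  then have "n a = 0"
    by (cases a) auto
  then show ?thesis
    using n[of a] by simp
qed

text \<open>Sample points are chosen for every coloring in advance, and finiteness keeps their set
  finite.\<close>

lemma finite_colorings: "finite {c. coloring w c}"
proof (rule finite_subset)
  show "{c. coloring w c} \<subseteq> strands w \<rightarrow>\<^sub>E UNIV"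
    by (auto simp: coloring_def)
qed (simp add: finite_PiE)

text \<open>Both colorings are folded onto the triangle with respect to the same sample points. The
  results \<open>d\<close> and \<open>d'\<close> then have the same heights there, and this forces
  them to agree on every strand.\<close>

theorem kempe_equivalent:
  assumes c: "coloring w c" "coloring w c'"
  shows "(kempe_step w)\<^sup>*\<^sup>* c c'"
proof -
  have "\<exists>B q. open B \<and> connected B \<and> q \<in> B \<and> q \<in> path_image (strand_curve w x) \<and> B \<inter> vs = {} \<and>
      (\<forall>y. y \<in> strands w \<longrightarrow> y \<noteq> x \<longrightarrow> path_image (strand_curve w y) \<inter> B = {})" if "x \<in> strands w" for x
    by (rule strand_neighborhood[OF that]) blast
  then obtain B q where B: "\<And>x. x \<in> strands w \<Longrightarrow> open (B x) \<and> connected (B x) \<and> q x \<in> B x \<and>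
      q x \<in> path_image (strand_curve w x) \<and> B x \<inter> vs = {} \<and>
      (\<forall>y. y \<in> strands w \<longrightarrow> y \<noteq> x \<longrightarrow> path_image (strand_curve w y) \<inter> B x = {})"
    by metis
  \<comment> \<open>All possible disagreements: a coloring \<open>d\<close>, a strand
    \<open>x\<close>, and a color \<open>b\<close> that another coloring might give to
    \<open>x\<close>. Each one receives a pair of sample points at which the height difference of
    \<open>d x\<close> and \<open>b\<close> jumps.\<close>
  define T where "T = (SIGMA d:{d. coloring w d}. SIGMA x:strands w. UNIV - {d x})"
  have "\<exists>z1 z2. z1 \<in> B x - web_image w \<and> z2 \<in> B x - web_image w \<and>
      height w d (d x) z1 - height w d b z1 \<noteq> height w d (d x) z2 - height w d b z2"
    if "(d, x, b) \<in> T" for d x b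
  proof -
    have *: "coloring w d" "x \<in> strands w" "d x \<noteq> b"
      using that by (auto simp: T_def)
    obtain z1 z2 where "z1 \<in> B x - web_image w" "z2 \<in> B x - web_image w"
      "height w d (d x) z1 - height w d b z1 \<noteq> height w d (d x) z2 - height w d b z2"
    proof (rule height_jump[OF *(1,2) refl *(3)])
      show "open (B x)" "connected (B x)" "q x \<in> B x" "q x \<in> path_image (strand_curve w x)"
        using B[OF *(2)] by auto
      show "path_image (strand_curve w y) \<inter> B x = {}" if "y \<in> strands w" "y \<noteq> x" for y
        using B[OF *(2)] that by auto
    qed
    then show ?thesis
      by blast
  qed
  then have "\<forall>t\<in>T. \<exists>z. case t of (d, x, b) \<Rightarrow> fst z \<in> B x - web_image w \<and> snd z \<in> B x - web_image w \<and>
      height w d (d x) (fst z) - height w d b (fst z) \<noteq> height w d (d x) (snd z) - height w d b (snd z)"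
    by fastforce
  from bchoice[OF this] obtain f where f: "\<forall>t\<in>T. case t of (d, x, b) \<Rightarrow>
      fst (f t) \<in> B x - web_image w \<and> snd (f t) \<in> B x - web_image w \<and>
      height w d (d x) (fst (f t)) - height w d b (fst (f t)) \<noteq>
        height w d (d x) (snd (f t)) - height w d b (snd (f t))"
    by blast
  define p where "p t = fst (f t)" for t
  define q' where "q' t = snd (f t)" for t
  have pq: "case t of (d, x, b) \<Rightarrow> p t \<in> B x - web_image w \<and> q' t \<in> B x - web_image w \<and>
      height w d (d x) (p t) - height w d b (p t) \<noteq> height w d (d x) (q' t) - height w d b (q' t)"
    if "t \<in> T" for t
    using f that unfolding p_def q'_def by blast
  define Z where "Z = p ` T \<union> q' ` T"
  have "finite T"
    unfolding T_def using finite_colorings by (intro finite_SigmaI) auto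
  then have "finite Z"
    by (simp add: Z_def)
  have "p t \<notin> web_image w \<and> q' t \<notin> web_image w" if "t \<in> T" for t
    using pq[OF that] by (cases t) auto
  then have Z: "Z \<inter> web_image w = {}"
    by (auto simp: Z_def)
  obtain d where d: "(kempe_step w)\<^sup>*\<^sup>* c d"
    "\<And>z. z \<in> Z \<Longrightarrow> height_diff_int d Red Green z \<in> {0, 1} \<and> height_diff_int d Green Blue z \<in> {0, 1} \<and>
       height_diff_int d Red Green z + height_diff_int d Green Blue z \<in> {0, 1}"
    by (rule kempe_minimal[OF c(1) \<open>finite Z\<close> Z]) (rule that)
  obtain d' where d': "(kempe_step w)\<^sup>*\<^sup>* c' d'"
    "\<And>z. z \<in> Z \<Longrightarrow> height_diff_int d' Red Green z \<in> {0, 1} \<and> height_diff_int d' Green Blue z \<in> {0, 1} \<and>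
       height_diff_int d' Red Green z + height_diff_int d' Green Blue z \<in> {0, 1}"
    by (rule kempe_minimal[OF c(2) \<open>finite Z\<close> Z]) (rule that)
  have col: "coloring w d" "coloring w d'"
    using kempe_equivalent_coloring d(1) d'(1) c by blast+
  have same: "height w d a z = height w d' a z" if "z \<in> Z" for a z
    using d(2)[OF that] d'(2)[OF that] that Z by (intro height_unique col) auto
  have "d x = d' x" if x: "x \<in> strands w" for x
  proof (rule ccontr)
    assume "d x \<noteq> d' x"
    then have t: "(d, x, d' x) \<in> T"
      using col x by (auto simp: T_def)
    define z1 where "z1 = p (d, x, d' x)"
    define z2 where "z2 = q' (d, x, d' x)"
    have z: "z1 \<in> B x" "z2 \<in> B x" "z1 \<in> Z" "z2 \<in> Z"
      "height w d (d x) z1 - height w d (d' x) z1 \<noteq> height w d (d x) z2 - height w d (d' x) z2"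
      using pq[OF t] t by (auto simp: z1_def z2_def Z_def)
    \<comment> \<open>Since \<open>d\<close> and \<open>d'\<close> have equal heights at the sample
      points, \<open>d'\<close> may be replaced by \<open>d\<close> here. Then the height difference
      for the colors \<open>d x\<close> and \<open>d' x\<close> would not change across
      \<open>x\<close>, contrary to the choice of \<open>z1\<close> and \<open>z2\<close>.\<close>
    have "height w d (d x) z1 - height w d' (d' x) z1 = height w d (d x) z2 - height w d' (d' x) z2"
      using B[OF x] z by (intro height_diff_const_across[OF col x refl refl, of "B x"]) auto
    then show False
      using z same by simp
  qed
  moreover have "d x = d' x" if "x \<notin> strands w" for x
    using col that by (auto simp: coloring_def PiE_def extensional_def)
  ultimately have "d = d'"
    by blast
  moreover have "symp (kempe_step w)\<^sup>*\<^sup>*"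
    using symp_rtranclp[OF symp_kempe_step] .
  ultimately show ?thesis
    using d(1) d'(1) by (metis rtranclp_trans sympD)
qed

end

theorem mainTheorem2:
  fixes w :: "('e, 'o) plane_web"
    and c c' :: "'e + 'o \<Rightarrow> web_color"
  assumes "closed_web w"
    and "coloring w c"
    and "coloring w c'"
  shows "\<exists>(n :: nat) cs. cs 0 = c \<and> cs n = c' \<and>
           (\<forall>i\<le>n. coloring w (cs i)) \<and>
           (\<forall>i<n. \<exists>u C. bicolored_cycle w (cs i) u C \<and>
                        cs (Suc i) = kempe_change u C (cs i))"
proof -
  have "(kempe_step w)\<^sup>*\<^sup>* c c'"
    using closed_web.kempe_equivalent[OF assms] .
  then obtain n cs where cs: "cs 0 = c" "cs n = c'" "\<And>i. i < n \<Longrightarrow> kempe_step w (cs i) (cs (Suc i))"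
    by (auto simp: rtranclp_power relpowp_fun_conv)
  have "coloring w (cs i)" if "i \<le> n" for i
    using cs(2) cs(3)[of i] that assms(3) by (cases "i = n") (auto simp: kempe_step_def)
  moreover have "\<exists>u C. bicolored_cycle w (cs i) u C \<and> cs (Suc i) = kempe_change u C (cs i)" if "i < n" for i
    using cs(3)[OF that] by (auto simp: kempe_step_def)
  ultimately show ?thesis
    using cs(1,2) by blast
qed

end
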